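(* Let $k$ be a field, $Q$ a finite quiver, $I\triangleleft kQ$ a two-sided ideal and $\Lambda=kQ/I$. Then $\Lambda$ is a string algebra over the local ring $R=k$ if and only if $\Lambda$ is a string algebra in the sense of Butler and Ringel.
   Context: Quivers: a finite quiver $Q=(Q_0,Q_1,h,t)$ has finite sets of vertices $Q_0$ and arrows $Q_1$, and head and tail maps $h,t:Q_1\to Q_0$. Each vertex $v$ has a trivial path $e_v$ of length $0$; a path of length $n\ge1$ is $a_n\cdots a_1$ with arrows satisfying $t(a_{i+1})=h(a_i)$. $RQ$ is the free $R$-module on the paths, with $pq$ the composition if $t(p)=h(q)$ and $0$ otherwise. For $\Lambda=RQ/I$, elements of $RQ$ are identified with their cosets when acting on $\Lambda$. For a module $M$, $\mathrm{rad}(M)$ is its Jacobson radical; $M$ is local if it has a unique maximal submodule (then equal to $\mathrm{rad}(M)$). String algebra over a commutative noetherian local ring $R$: an $R$-algebra $\Lambda=RQ/I$, with $Q$ finite, that is finitely generated as an $R$-module and such that each vertex is the head of at most $2$ arrows and the tail of at most $2$ arrows, and $I$ is: - arrow-radical: for every vertex $v$, $\Lambda e_v$ is a local left module with $\mathrm{rad}(\Lambda e_v)=\sum_{t(a)=v}\Lambda a$, and $e_v\Lambda$ is a local right module with $\mathrm{rad}(e_v\Lambda)=\sum_{h(a)=v}a\Lambda$ (sums over arrows $a$); - arrow-direct: for every arrow $a$, $\Lambda a\cap\sum\Lambda b=0$ with sum over arrows $b\neq a$ with $t(b)=t(a)$, and $a\Lambda\cap\sum b\Lambda=0$ with sum over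 arrows $b\ne a$ with $h(b)=h(a)$; - permissible: $a\notin I$ for every arrow $a$; - special: for every arrow $b$ there is at most one arrow $a$ with $t(a)=h(b)$ and $ab\notin I$, and at most one arrow $c$ with $h(c)=t(b)$ and $bc\notin I$. String algebra in the sense of Butler and Ringel (with finite quiver): $\Lambda=kQ/I$ where $I$ is generated as a two-sided ideal by a set of paths of length at least $2$, and: (1),(1* ) each vertex is the tail of at most two arrows and the head of at most two arrows; (2),(2* ) for each arrow $b$ there is at most one arrow $a$ with $t(a)=h(b)$ and $ab\notin I$, and at most one arrow $c$ with $h(c)=t(b)$ and $bc\notin I$; (3),(3* ) for each arrow $b$ there is an integer $n(b)$ such that every path of length at least $n(b)$ whose first (rightmost) arrow is $b$ lies in $I$, and every path of length at least $n(b)$ whose last (leftmost) arrow is $b$ lies in $I$. *)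

theory Defs
  imports "HOL-Algebra.Ring_Divisibility" "Graph_Theory.Arc_Walk"
begin

section \<open>Quivers and path algebras\<close>

text \<open>A finite quiver is a \<^locale>\<open>fin_digraph\<close>; loops and multiple arrows are allowed there.
  A path is stored as its source together with its arrows in the order in which they are
  traversed, so the path written \<open>a\<^sub>n \<dots> a\<^sub>1\<close> is \<open>(tail a\<^sub>1, [a\<^sub>1, \<dots>, a\<^sub>n])\<close>, and
  the trivial path at \<open>v\<close> is \<open>(v, [])\<close>.\<close>

type_synonym ('v, 'e) qpath = "'v \<times> 'e list"

definition qpaths :: "('v, 'e) pre_digraph \<Rightarrow> ('v, 'e) qpath set"
  where "qpaths Q = {(u, as). \<exists>v. pre_digraph.awalk Q u as v}"

definition path_source :: "('v, 'e) qpath \<Rightarrow> 'v"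
  where "path_source p = fst p"

definition path_target :: "('v, 'e) pre_digraph \<Rightarrow> ('v, 'e) qpath \<Rightarrow> 'v"
  where "path_target Q p = pre_digraph.awlast Q (fst p) (snd p)"

definition path_length :: "('v, 'e) qpath \<Rightarrow> nat"
  where "path_length p = length (snd p)"

definition trivial_path :: "'v \<Rightarrow> ('v, 'e) qpath"
  where "trivial_path v = (v, [])"

definition arrow_path :: "('v, 'e) pre_digraph \<Rightarrow> 'e \<Rightarrow> ('v, 'e) qpath"
  where "arrow_path Q a = (tail Q a, [a])"

text \<open>\<open>path_comp p q\<close> is \<open>pq\<close>: first \<open>q\<close>, then \<open>p\<close>.\<close>

definition path_comp :: "('v, 'e) qpath \<Rightarrow> ('v, 'e) qpath \<Rightarrow> ('v, 'e) qpath"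
  where "path_comp p q = (fst q, snd q @ snd p)"

definition path_factorizations ::
    "('v, 'e) pre_digraph \<Rightarrow> ('v, 'e) qpath \<Rightarrow> (('v, 'e) qpath \<times> ('v, 'e) qpath) set"
  where "path_factorizations Q x =
    {(p, q). p \<in> qpaths Q \<and> q \<in> qpaths Q \<and> path_source p = path_target Q q \<and> path_comp p q = x}"

text \<open>The free \<open>R\<close>-module on the paths consists of the finitely supported coefficient functions,
  extended by zero to all pairs that are not paths. The multiplication is the bilinear extension
  of \<open>p \<cdot> q = pq\<close> if \<open>t(p) = h(q)\<close> and \<open>p \<cdot> q = 0\<close> otherwise; a path has only finitely many
  factorizations.\<close>

definition path_algebra ::
    "('r, 's) ring_scheme \<Rightarrow> ('v, 'e) pre_digraph \<Rightarrow> ('r, ('v, 'e) qpath \<Rightarrow> 'r) module"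
  where "path_algebra R Q =
    \<lparr>carrier = {f. (\<forall>p. f p \<in> carrier R) \<and> (\<forall>p. p \<notin> qpaths Q \<longrightarrow> f p = \<zero>\<^bsub>R\<^esub>) \<and>
        finite {p. f p \<noteq> \<zero>\<^bsub>R\<^esub>}},
     monoid.mult = (\<lambda>f g x. \<Oplus>\<^bsub>R\<^esub>d \<in> path_factorizations Q x. f (fst d) \<otimes>\<^bsub>R\<^esub> g (snd d)),
     one = (\<lambda>p. if p \<in> trivial_path ` verts Q then \<one>\<^bsub>R\<^esub> else \<zero>\<^bsub>R\<^esub>),
     ring.zero = (\<lambda>p. \<zero>\<^bsub>R\<^esub>),
     add = (\<lambda>f g p. f p \<oplus>\<^bsub>R\<^esub> g p),
     smult = (\<lambda>r f p. r \<otimes>\<^bsub>R\<^esub> f p)\<rparr>"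

definition path_elem :: "('r, 's) ring_scheme \<Rightarrow> ('v, 'e) qpath \<Rightarrow> ('v, 'e) qpath \<Rightarrow> 'r"
  where "path_elem R p = (\<lambda>q. if q = p then \<one>\<^bsub>R\<^esub> else \<zero>\<^bsub>R\<^esub>)"

abbreviation arrow_elem ::
    "('r, 's) ring_scheme \<Rightarrow> ('v, 'e) pre_digraph \<Rightarrow> 'e \<Rightarrow> ('v, 'e) qpath \<Rightarrow> 'r"
  where "arrow_elem R Q a \<equiv> path_elem R (arrow_path Q a)"

text \<open>\<^const>\<open>FactRing\<close> with the induced scalar multiplication \<open>r (x + I) = r x + I\<close>.\<close>

definition quotient_algebra ::
    "('r, 'a, 's) module_scheme \<Rightarrow> 'a set \<Rightarrow> ('r, 'a set) module"
  where "quotient_algebra A I =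
    \<lparr>carrier = carrier (A Quot I), monoid.mult = monoid.mult (A Quot I), one = one (A Quot I),
     ring.zero = ring.zero (A Quot I), add = add (A Quot I),
     smult = (\<lambda>r X. \<Union>x\<in>X. I +>\<^bsub>A\<^esub> (r \<odot>\<^bsub>A\<^esub> x))\<rparr>"

abbreviation quiver_algebra ::
    "('r, 's) ring_scheme \<Rightarrow> ('v, 'e) pre_digraph \<Rightarrow> (('v, 'e) qpath \<Rightarrow> 'r) set
      \<Rightarrow> ('r, (('v, 'e) qpath \<Rightarrow> 'r) set) module"
  where "quiver_algebra R Q I \<equiv> quotient_algebra (path_algebra R Q) I"

definition vertex_coset ::
    "('r, 's) ring_scheme \<Rightarrow> ('v, 'e) pre_digraph \<Rightarrow> (('v, 'e) qpath \<Rightarrow> 'r) set \<Rightarrow> 'v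
      \<Rightarrow> (('v, 'e) qpath \<Rightarrow> 'r) set"
  where "vertex_coset R Q I v = I +>\<^bsub>path_algebra R Q\<^esub> path_elem R (trivial_path v)"

definition arrow_coset ::
    "('r, 's) ring_scheme \<Rightarrow> ('v, 'e) pre_digraph \<Rightarrow> (('v, 'e) qpath \<Rightarrow> 'r) set \<Rightarrow> 'e
      \<Rightarrow> (('v, 'e) qpath \<Rightarrow> 'r) set"
  where "arrow_coset R Q I a = I +>\<^bsub>path_algebra R Q\<^esub> arrow_elem R Q a"


section \<open>The path algebra is an algebra\<close>

text \<open>The locale \<^locale>\<open>ideal\<close> presupposes a ring, so the lemmas below are what makes
  \<open>ideal I (path_algebra R Q)\<close> a condition on \<open>I\<close> alone. \<open>path_elem_mult\<close> and \<open>smult_coset\<close>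
  confirm the product of paths and the scalar multiplication on the quotient.\<close>

lemma (in abelian_monoid) finsum_Sigma:
  assumes "finite A" "\<And>x. x \<in> A \<Longrightarrow> finite (B x)"
    and "\<And>x y. x \<in> A \<Longrightarrow> y \<in> B x \<Longrightarrow> f x y \<in> carrier G"
  shows "(\<Oplus>x\<in>A. \<Oplus>y\<in>B x. f x y) = (\<Oplus>z\<in>Sigma A B. f (fst z) (snd z))"
  using assms
proof (induction A rule: finite_induct)
  case (insert a A)
  have S: "Sigma (insert a A) B = (Pair a ` B a) \<union> Sigma A B" by auto
  have "(\<Oplus>z\<in>Sigma (insert a A) B. f (fst z) (snd z)) =
     (\<Oplus>z\<in>Pair a ` B a. f (fst z) (snd z)) \<oplus> (\<Oplus>z\<in>Sigma A B. f (fst z) (snd z))"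
    unfolding S using insert by (intro finsum_Un_disjoint) (auto simp: Pi_def)
  also have "(\<Oplus>z\<in>Pair a ` B a. f (fst z) (snd z)) = (\<Oplus>y\<in>B a. f a y)"
    by (subst finsum_reindex) (use insert in \<open>auto simp: inj_on_def\<close>)
  finally show ?case using insert by (subst finsum_insert) (auto intro!: finsum_closed)
qed auto

locale quiver_path_algebra = R: cring R + Q: fin_digraph Q
  for R :: "('r, 's) ring_scheme" (structure) and Q :: "('v, 'e) pre_digraph"
begin

abbreviation "F \<equiv> path_factorizations Q"
abbreviation "PA \<equiv> path_algebra R Q"

lemma path_iff: "p \<in> qpaths Q \<longleftrightarrow> Q.awalk (fst p) (snd p) (path_target Q p)"
  by (auto simp: qpaths_def path_target_def split: prod.splits)

lemma comp_path:
  "p \<in> qpaths Q \<Longrightarrow> q \<in> qpaths Q \<Longrightarrow> path_source p = path_target Q q \<Longrightarrow> path_comp p q \<in> qpaths Q"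
  by (cases p; cases q) (auto simp: path_iff path_target_def path_source_def path_comp_def Q.awlast_append)

lemma target_comp: "path_source p = path_target Q q \<Longrightarrow> path_target Q (path_comp p q) = path_target Q p"
  by (simp add: path_target_def path_source_def path_comp_def Q.awlast_append)

lemma finite_F: "finite (F x)"
proof (rule finite_subset)
  show "F x \<subseteq> (\<lambda>i. ((Q.awlast (fst x) (take i (snd x)), drop i (snd x)), (fst x, take i (snd x)))) ` {..length (snd x)}"
  proof
    fix d assume "d \<in> F x"
    then obtain p q where d: "d = (p,q)" "path_source p = path_target Q q" "path_comp p q = x"
      by (auto simp: path_factorizations_def)
    hence "snd x = snd q @ snd p" "fst x = fst q" by (auto simp: path_comp_def)
    with d show "d \<in> (\<lambda>i. ((Q.awlast (fst x) (take i (snd x)), drop i (snd x)), (fst x, take i (snd x)))) ` {..length (snd x)}"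
      by (intro image_eqI[of _ _ "length (snd q)"])
        (auto simp: path_source_def path_target_def path_comp_def prod_eq_iff)
  qed
qed auto

lemma F_nonpath: "x \<notin> qpaths Q \<Longrightarrow> F x = {}"
  using comp_path by (auto simp: path_factorizations_def)

lemma carrierI: "(\<And>p. f p \<in> carrier R) \<Longrightarrow> (\<And>p. p \<notin> qpaths Q \<Longrightarrow> f p = \<zero>) \<Longrightarrow>
   finite {p. f p \<noteq> \<zero>} \<Longrightarrow> f \<in> carrier PA"
  by (auto simp: path_algebra_def)
lemma carrierD: assumes "f \<in> carrier PA"
  shows "f p \<in> carrier R" "p \<notin> qpaths Q \<Longrightarrow> f p = \<zero>" "finite {p. f p \<noteq> \<zero>}"
  using assms unfolding path_algebra_def by (simp_all del: split_paired_All)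

lemma mult_eq: "(f \<otimes>\<^bsub>PA\<^esub> g) x = (\<Oplus>d \<in> F x. f (fst d) \<otimes> g (snd d))"
  by (simp add: path_algebra_def)
lemma add_eq: "(f \<oplus>\<^bsub>PA\<^esub> g) x = f x \<oplus> g x"
  by (simp add: path_algebra_def)
lemma zero_eq: "(\<zero>\<^bsub>PA\<^esub>) x = \<zero>"
  by (simp add: path_algebra_def)
lemma one_eq: "(\<one>\<^bsub>PA\<^esub>) p = (if p \<in> trivial_path ` verts Q then \<one> else \<zero>)"
  by (simp add: path_algebra_def)
lemma smult_eq: "(r \<odot>\<^bsub>PA\<^esub> f) p = r \<otimes> f p"
  by (simp add: path_algebra_def)

lemma mult_closed: assumes "f \<in> carrier PA" "g \<in> carrier PA" shows "f \<otimes>\<^bsub>PA\<^esub> g \<in> carrier PA"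
proof (rule carrierI)
  note c = carrierD[OF assms(1)] carrierD[OF assms(2)]
  show "(f \<otimes>\<^bsub>PA\<^esub> g) p \<in> carrier R" for p
    unfolding mult_eq by (rule R.finsum_closed) (auto simp: c)
  show "(f \<otimes>\<^bsub>PA\<^esub> g) p = \<zero>" if "p \<notin> qpaths Q" for p
    unfolding mult_eq using that by (simp add: F_nonpath)
  have "{p. (f \<otimes>\<^bsub>PA\<^esub> g) p \<noteq> \<zero>} \<subseteq> (\<lambda>(p,q). path_comp p q) ` ({p. f p \<noteq> \<zero>} \<times> {p. g p \<noteq> \<zero>})"
  proof (rule subsetI, rule ccontr)
    fix x assume x: "x \<in> {p. (f \<otimes>\<^bsub>PA\<^esub> g) p \<noteq> \<zero>}"
      "x \<notin> (\<lambda>(p,q). path_comp p q) ` ({p. f p \<noteq> \<zero>} \<times> {p. g p \<noteq> \<zero>})"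
    have "f (fst d) \<otimes> g (snd d) = \<zero>" if "d \<in> F x" for d
    proof -
      have "path_comp (fst d) (snd d) = x" using that by (auto simp: path_factorizations_def)
      hence "f (fst d) = \<zero> \<or> g (snd d) = \<zero>" using x(2) by force
      thus ?thesis using c(1)[of "fst d"] c(4)[of "snd d"] by (elim disjE) simp_all
    qed
    hence "(f \<otimes>\<^bsub>PA\<^esub> g) x = \<zero>" unfolding mult_eq
      by (intro R.add.finprod_one_eqI) auto
    thus False using x by simp
  qed
  thus "finite {p. (f \<otimes>\<^bsub>PA\<^esub> g) p \<noteq> \<zero>}" by (rule finite_subset) (auto simp: c)
qed

lemma mult_assoc: assumes "f \<in> carrier PA" "g \<in> carrier PA" "h \<in> carrier PA"
  shows "(f \<otimes>\<^bsub>PA\<^esub> g) \<otimes>\<^bsub>PA\<^esub> h = f \<otimes>\<^bsub>PA\<^esub> (g \<otimes>\<^bsub>PA\<^esub> h)"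
proof
  fix x
  have pt: "path_target Q (path_target Q (u, a), b) = path_target Q (u, a @ b)" for u a b
    by (simp add: path_target_def Q.awlast_append)
  note c [simp] = carrierD(1)[OF assms(1)] carrierD(1)[OF assms(2)] carrierD(1)[OF assms(3)]
  let ?A = "Sigma (F x) (\<lambda>d. F (fst d))" and ?B = "Sigma (F x) (\<lambda>d. F (snd d))"
  let ?i = "\<lambda>z. ((fst (snd z), path_comp (snd (snd z)) (snd (fst z))), (snd (snd z), snd (fst z)))"
  let ?j = "\<lambda>z. ((path_comp (fst (fst z)) (fst (snd z)), snd (snd z)), (fst (fst z), fst (snd z)))"
  have bij: "bij_betw ?i ?A ?B"
  proof (rule bij_betw_byWitness[where f' = ?j])
    show "\<forall>a\<in>?A. ?j (?i a) = a" by (auto simp: path_factorizations_def)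
    show "\<forall>a\<in>?B. ?i (?j a) = a" by (auto simp: path_factorizations_def)
    show "?i ` ?A \<subseteq> ?B"
      by (auto simp: path_factorizations_def target_comp intro!: comp_path)
       (auto simp: path_comp_def path_source_def pt)
    show "?j ` ?B \<subseteq> ?A"
      by (auto simp: path_factorizations_def target_comp intro!: comp_path)
       (auto simp: path_comp_def path_source_def pt)
  qed
  have "((f \<otimes>\<^bsub>PA\<^esub> g) \<otimes>\<^bsub>PA\<^esub> h) x =
     (\<Oplus>d\<in>F x. \<Oplus>e\<in>F (fst d). f (fst e) \<otimes> g (snd e) \<otimes> h (snd d))"
    unfolding mult_eq by (intro R.finsum_cong' R.finsum_ldistr) (auto simp: finite_F intro!: R.finsum_closed)
  also have "\<dots> = (\<Oplus>z\<in>?A. f (fst (snd z)) \<otimes> g (snd (snd z)) \<otimes> h (snd (fst z)))"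
    by (rule R.finsum_Sigma) (auto simp: finite_F)
  also have "\<dots> = (\<Oplus>z\<in>?A. f (fst (fst (?i z))) \<otimes> (g (fst (snd (?i z))) \<otimes> h (snd (snd (?i z)))))"
    by (rule R.finsum_cong') (auto simp: R.m_assoc)
  also have "\<dots> = (\<Oplus>z\<in>?B. f (fst (fst z)) \<otimes> (g (fst (snd z)) \<otimes> h (snd (snd z))))"
  proof -
    have "inj_on ?i ?A" "?i ` ?A = ?B" using bij by (simp_all only: bij_betw_def)
    thus ?thesis
      using R.finsum_reindex[of "\<lambda>z. f (fst (fst z)) \<otimes> (g (fst (snd z)) \<otimes> h (snd (snd z)))" ?i ?A]
      by (simp only:) (simp add: Pi_def)
  qed
  also have "\<dots> = (\<Oplus>d\<in>F x. \<Oplus>e\<in>F (snd d). f (fst d) \<otimes> (g (fst e) \<otimes> h (snd e)))"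
    by (rule R.finsum_Sigma[symmetric]) (auto simp: finite_F)
  also have "\<dots> = (f \<otimes>\<^bsub>PA\<^esub> (g \<otimes>\<^bsub>PA\<^esub> h)) x"
    unfolding mult_eq by (intro R.finsum_cong' R.finsum_rdistr[symmetric]) (auto simp: finite_F intro!: R.finsum_closed)
  finally show "((f \<otimes>\<^bsub>PA\<^esub> g) \<otimes>\<^bsub>PA\<^esub> h) x = (f \<otimes>\<^bsub>PA\<^esub> (g \<otimes>\<^bsub>PA\<^esub> h)) x" .
qed

lemma triv_path: "v \<in> verts Q \<Longrightarrow> trivial_path v \<in> qpaths Q"
  by (auto simp: qpaths_def trivial_path_def Q.awalk_Nil_iff)

lemma one_mult: assumes f: "f \<in> carrier PA"
  shows "\<one>\<^bsub>PA\<^esub> \<otimes>\<^bsub>PA\<^esub> f = f" "f \<otimes>\<^bsub>PA\<^esub> \<one>\<^bsub>PA\<^esub> = f"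
proof -
  note c = carrierD[OF f]
  have "(\<one>\<^bsub>PA\<^esub> \<otimes>\<^bsub>PA\<^esub> f) x = f x \<and> (f \<otimes>\<^bsub>PA\<^esub> \<one>\<^bsub>PA\<^esub>) x = f x" for x
  proof (cases "x \<in> qpaths Q")
    case False thus ?thesis by (simp add: mult_eq F_nonpath c)
  next
    case True
    let ?l = "(trivial_path (path_target Q x), x)" and ?r = "(x, trivial_path (path_source x))"
    have tv: "path_target Q x \<in> verts Q" using True by (auto simp: path_iff dest: Q.awalk_last_in_verts)
    have sv: "path_source x \<in> verts Q" using True by (auto simp: path_iff path_source_def dest: Q.awalk_hd_in_verts)
    have l: "?l \<in> F x" and r: "?r \<in> F x" using True triv_path[OF tv] triv_path[OF sv]
      by (auto simp: path_factorizations_def trivial_path_def path_comp_def path_source_def path_target_def)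
    have *: "(\<one>\<^bsub>PA\<^esub>) (fst d) \<otimes> f (snd d) = (if ?l = d then f (snd d) else \<zero>)" if "d \<in> F x" for d
      using that tv c
      by (auto simp: one_eq path_factorizations_def trivial_path_def path_comp_def path_source_def prod_eq_iff image_iff)
    have **: "f (fst d) \<otimes> (\<one>\<^bsub>PA\<^esub>) (snd d) = (if ?r = d then f (fst d) else \<zero>)" if "d \<in> F x" for d
      using that sv c
      by (auto simp: one_eq path_factorizations_def trivial_path_def path_comp_def path_source_def path_target_def prod_eq_iff image_iff)
    have "(\<one>\<^bsub>PA\<^esub> \<otimes>\<^bsub>PA\<^esub> f) x = (\<Oplus>d\<in>F x. if ?l = d then f (snd d) else \<zero>)"
      unfolding mult_eq by (rule R.finsum_cong') (auto simp: * c)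
    also have "\<dots> = f (snd ?l)" using R.finsum_singleton[OF l finite_F, of "\<lambda>d. f (snd d)"] c(1) by (simp add: Pi_def)
    finally have 1: "(\<one>\<^bsub>PA\<^esub> \<otimes>\<^bsub>PA\<^esub> f) x = f x" by simp
    have "(f \<otimes>\<^bsub>PA\<^esub> \<one>\<^bsub>PA\<^esub>) x = (\<Oplus>d\<in>F x. if ?r = d then f (fst d) else \<zero>)"
      unfolding mult_eq by (rule R.finsum_cong') (auto simp: ** c)
    also have "\<dots> = f (fst ?r)" using R.finsum_singleton[OF r finite_F, of "\<lambda>d. f (fst d)"] c(1) by (simp add: Pi_def)
    finally show ?thesis using 1 by simp
  qed
  thus "\<one>\<^bsub>PA\<^esub> \<otimes>\<^bsub>PA\<^esub> f = f" "f \<otimes>\<^bsub>PA\<^esub> \<one>\<^bsub>PA\<^esub> = f" by auto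
qed

lemma add_closed: assumes "f \<in> carrier PA" "g \<in> carrier PA" shows "f \<oplus>\<^bsub>PA\<^esub> g \<in> carrier PA"
proof (rule carrierI)
  note c = carrierD[OF assms(1)] carrierD[OF assms(2)]
  show "finite {p. (f \<oplus>\<^bsub>PA\<^esub> g) p \<noteq> \<zero>}"
    by (rule finite_subset[OF _ finite_UnI[OF c(3) c(6)]]) (auto simp: add_eq)
qed (use carrierD[OF assms(1)] carrierD[OF assms(2)] in \<open>auto simp: add_eq\<close>)

lemma smult_closed: assumes "r \<in> carrier R" "f \<in> carrier PA" shows "r \<odot>\<^bsub>PA\<^esub> f \<in> carrier PA"
proof (rule carrierI)
  note c = carrierD[OF assms(2)]
  show "finite {p. (r \<odot>\<^bsub>PA\<^esub> f) p \<noteq> \<zero>}"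
    by (rule finite_subset[OF _ c(3)]) (use assms in \<open>auto simp: smult_eq\<close>)
qed (use assms carrierD[OF assms(2)] in \<open>auto simp: smult_eq\<close>)

lemma zero_closed: "\<zero>\<^bsub>PA\<^esub> \<in> carrier PA"
  by (rule carrierI) (auto simp: zero_eq)

lemma one_closed: "\<one>\<^bsub>PA\<^esub> \<in> carrier PA"
proof (rule carrierI)
  show "finite {p. (\<one>\<^bsub>PA\<^esub>) p \<noteq> \<zero>}"
    by (rule finite_subset[of _ "trivial_path ` verts Q"]) (auto simp: one_eq split: if_splits)
qed (auto simp: one_eq triv_path)

lemma abelian: "abelian_group PA"
proof (rule abelian_groupI)
  fix f assume f: "f \<in> carrier PA"
  show "\<exists>y\<in>carrier PA. y \<oplus>\<^bsub>PA\<^esub> f = \<zero>\<^bsub>PA\<^esub>"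
    by (rule bexI[of _ "(\<ominus> \<one>) \<odot>\<^bsub>PA\<^esub> f"])
      (auto simp: fun_eq_iff add_eq smult_eq zero_eq carrierD(1)[OF f] R.l_minus R.l_neg intro!: smult_closed f)
qed (auto simp: add_closed zero_closed fun_eq_iff add_eq zero_eq carrierD(1) R.a_ac)

lemma ring_path_algebra: "ring PA"
proof (rule ringI[OF abelian])
  show "monoid PA"
    by (rule monoidI) (auto simp: mult_closed one_closed mult_assoc one_mult)
  fix f g h assume c0: "f \<in> carrier PA" "g \<in> carrier PA" "h \<in> carrier PA"
  note c [simp] = c0[THEN carrierD(1)]
  show "(f \<oplus>\<^bsub>PA\<^esub> g) \<otimes>\<^bsub>PA\<^esub> h = f \<otimes>\<^bsub>PA\<^esub> h \<oplus>\<^bsub>PA\<^esub> g \<otimes>\<^bsub>PA\<^esub> h"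
    by (auto simp: fun_eq_iff add_eq mult_eq R.l_distr Pi_def simp flip: R.finsum_addf)
  show "h \<otimes>\<^bsub>PA\<^esub> (f \<oplus>\<^bsub>PA\<^esub> g) = h \<otimes>\<^bsub>PA\<^esub> f \<oplus>\<^bsub>PA\<^esub> h \<otimes>\<^bsub>PA\<^esub> g"
    by (auto simp: fun_eq_iff add_eq mult_eq R.r_distr Pi_def simp flip: R.finsum_addf)
qed

lemma module_path_algebra: "module R PA"
  by (rule moduleI[OF R.is_cring abelian])
    (auto simp: smult_closed fun_eq_iff add_eq smult_eq carrierD(1) R.l_distr R.r_distr R.m_assoc)

lemma smult_mult: assumes "r \<in> carrier R" "f \<in> carrier PA" "g \<in> carrier PA"
  shows "(r \<odot>\<^bsub>PA\<^esub> f) \<otimes>\<^bsub>PA\<^esub> g = r \<odot>\<^bsub>PA\<^esub> (f \<otimes>\<^bsub>PA\<^esub> g)"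
  using assms carrierD(1)[OF assms(2)] carrierD(1)[OF assms(3)]
  by (auto simp: fun_eq_iff smult_eq mult_eq R.finsum_rdistr finite_F Pi_def R.m_assoc intro!: R.finsum_cong')

lemma path_elem_closed: "p \<in> qpaths Q \<Longrightarrow> path_elem R p \<in> carrier PA"
  by (rule carrierI) (auto simp: path_elem_def)

lemma path_elem_mult: assumes "p \<in> qpaths Q" "q \<in> qpaths Q"
  shows "path_elem R p \<otimes>\<^bsub>PA\<^esub> path_elem R q =
     (if path_source p = path_target Q q then path_elem R (path_comp p q) else \<zero>\<^bsub>PA\<^esub>)"
proof
  fix x
  have "(path_elem R p \<otimes>\<^bsub>PA\<^esub> path_elem R q) x = (\<Oplus>d\<in>F x. if (p,q) = d then \<one> else \<zero>)"
    unfolding mult_eq by (rule R.finsum_cong') (auto simp: path_elem_def)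
  also have "\<dots> = (if (p,q) \<in> F x then \<one> else \<zero>)"
  proof (cases "(p,q) \<in> F x")
    case True thus ?thesis using R.finsum_singleton[OF True finite_F, of "\<lambda>_. \<one>"] by simp
  next
    case False
    hence "(\<Oplus>d\<in>F x. if (p,q) = d then \<one> else \<zero>) = \<zero>" by (intro R.add.finprod_one_eqI) auto
    thus ?thesis using False by simp
  qed
  finally show "(path_elem R p \<otimes>\<^bsub>PA\<^esub> path_elem R q) x =
    (if path_source p = path_target Q q then path_elem R (path_comp p q) else \<zero>\<^bsub>PA\<^esub>) x"
    using assms by (auto simp: path_factorizations_def path_elem_def zero_eq)
qed

lemma smult_coset: assumes "ideal I PA" "r \<in> carrier R" "f \<in> carrier PA"
  shows "r \<odot>\<^bsub>quiver_algebra R Q I\<^esub> (I +>\<^bsub>PA\<^esub> f) = I +>\<^bsub>PA\<^esub> (r \<odot>\<^bsub>PA\<^esub> f)"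
proof -
  interpret I: ideal I PA by fact
  interpret M: module R PA by (rule module_path_algebra)
  have sI: "r \<odot>\<^bsub>PA\<^esub> i \<in> I" if "i \<in> I" for i
  proof -
    have i: "i \<in> carrier PA" using that by (rule I.a_Hcarr)
    have "r \<odot>\<^bsub>PA\<^esub> i = (r \<odot>\<^bsub>PA\<^esub> \<one>\<^bsub>PA\<^esub>) \<otimes>\<^bsub>PA\<^esub> i"
      by (simp only: smult_mult[OF assms(2) one_closed i] one_mult(1)[OF i])
    thus ?thesis using I.I_l_closed[OF that smult_closed[OF assms(2) one_closed]] by (simp only:)
  qed
  have "I +>\<^bsub>PA\<^esub> (r \<odot>\<^bsub>PA\<^esub> x) = I +>\<^bsub>PA\<^esub> (r \<odot>\<^bsub>PA\<^esub> f)" if "x \<in> I +>\<^bsub>PA\<^esub> f" for x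
  proof -
    from that obtain i where i: "i \<in> I" "x = i \<oplus>\<^bsub>PA\<^esub> f" unfolding a_r_coset_def' UN_iff singleton_iff by (elim bexE)
    have "r \<odot>\<^bsub>PA\<^esub> x = r \<odot>\<^bsub>PA\<^esub> i \<oplus>\<^bsub>PA\<^esub> r \<odot>\<^bsub>PA\<^esub> f"
      unfolding i(2) by (rule M.smult_r_distr[OF assms(2) I.a_Hcarr[OF i(1)] assms(3)])
    with sI[OF i(1)] have m: "r \<odot>\<^bsub>PA\<^esub> x \<in> I +>\<^bsub>PA\<^esub> (r \<odot>\<^bsub>PA\<^esub> f)"
      unfolding a_r_coset_def' UN_iff singleton_iff by (intro bexI)
    have "subgroup I (add_monoid PA)" by (rule I.a_subgroup)
    from I.a_repr_independence[OF m smult_closed[OF assms(2,3)] this] show ?thesis by (rule sym)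
  qed
  moreover have "f \<in> I +>\<^bsub>PA\<^esub> f" by (rule I.a_rcos_self[OF assms(3)])
  ultimately have "(\<Union>x\<in>I +>\<^bsub>PA\<^esub> f. I +>\<^bsub>PA\<^esub> (r \<odot>\<^bsub>PA\<^esub> x)) = I +>\<^bsub>PA\<^esub> (r \<odot>\<^bsub>PA\<^esub> f)"
    by (intro UN_constant_eq ballI)
  thus ?thesis unfolding quotient_algebra_def module.simps .
qed

end


section \<open>One-sided modules inside a ring\<close>

text \<open>The modules \<open>\<Lambda>e\<^sub>v\<close> and \<open>e\<^sub>v\<Lambda>\<close> are one-sided ideals of \<open>\<Lambda>\<close>, and their submodules are the
  one-sided ideals of \<open>\<Lambda>\<close> contained in them. Maximality, radical and locality are stated relative
  to a predicate \<open>sub\<close>, which is \<open>left_ideal \<Lambda>\<close> or \<open>right_ideal \<Lambda>\<close>.\<close>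

definition left_ideal :: "('a, 's) ring_scheme \<Rightarrow> 'a set \<Rightarrow> bool"
  where "left_ideal A N \<longleftrightarrow>
    additive_subgroup N A \<and> (\<forall>a \<in> carrier A. \<forall>x \<in> N. a \<otimes>\<^bsub>A\<^esub> x \<in> N)"

definition right_ideal :: "('a, 's) ring_scheme \<Rightarrow> 'a set \<Rightarrow> bool"
  where "right_ideal A N \<longleftrightarrow>
    additive_subgroup N A \<and> (\<forall>a \<in> carrier A. \<forall>x \<in> N. x \<otimes>\<^bsub>A\<^esub> a \<in> N)"

definition maximal_submodule :: "('a set \<Rightarrow> bool) \<Rightarrow> 'a set \<Rightarrow> 'a set \<Rightarrow> bool"
  where "maximal_submodule sub M N \<longleftrightarrow>
    sub N \<and> N \<subset> M \<and> (\<forall>N'. sub N' \<and> N \<subseteq> N' \<and> N' \<subseteq> M \<longrightarrow> N' = N \<or> N' = M)"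

definition module_rad :: "('a set \<Rightarrow> bool) \<Rightarrow> 'a set \<Rightarrow> 'a set"
  where "module_rad sub M = M \<inter> \<Inter>{N. maximal_submodule sub M N}"

definition local_module :: "('a set \<Rightarrow> bool) \<Rightarrow> 'a set \<Rightarrow> bool"
  where "local_module sub M \<longleftrightarrow> (\<exists>!N. maximal_submodule sub M N)"

text \<open>\<open>\<Sum>\<^sub>i \<Lambda> x\<^sub>i\<close> and \<open>\<Sum>\<^sub>i x\<^sub>i \<Lambda>\<close> for a finite family.\<close>

definition left_sum :: "('a, 's) ring_scheme \<Rightarrow> ('i \<Rightarrow> 'a) \<Rightarrow> 'i set \<Rightarrow> 'a set"
  where "left_sum A x S = {\<Oplus>\<^bsub>A\<^esub>i \<in> S. c i \<otimes>\<^bsub>A\<^esub> x i | c. c \<in> S \<rightarrow> carrier A}"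

definition right_sum :: "('a, 's) ring_scheme \<Rightarrow> ('i \<Rightarrow> 'a) \<Rightarrow> 'i set \<Rightarrow> 'a set"
  where "right_sum A x S = {\<Oplus>\<^bsub>A\<^esub>i \<in> S. x i \<otimes>\<^bsub>A\<^esub> c i | c. c \<in> S \<rightarrow> carrier A}"

definition finitely_generated_module :: "('r, 's) ring_scheme \<Rightarrow> ('r, 'm, 't) module_scheme \<Rightarrow> bool"
  where "finitely_generated_module R M \<longleftrightarrow>
    (\<exists>S. finite S \<and> S \<subseteq> carrier M \<and>
      carrier M = {\<Oplus>\<^bsub>M\<^esub>s \<in> S. c s \<odot>\<^bsub>M\<^esub> s | c. c \<in> S \<rightarrow> carrier R})"


section \<open>String algebras over a commutative noetherian local ring\<close>

definition commutative_noetherian_local_ring :: "('r, 's) ring_scheme \<Rightarrow> bool"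
  where "commutative_noetherian_local_ring R \<longleftrightarrow>
    cring R \<and> noetherian_ring R \<and> (\<exists>!M. maximalideal M R)"

definition at_most_two_heads_and_tails :: "('v, 'e) pre_digraph \<Rightarrow> bool"
  where "at_most_two_heads_and_tails Q \<longleftrightarrow>
    (\<forall>v \<in> verts Q. in_degree Q v \<le> 2 \<and> out_degree Q v \<le> 2)"

definition arrow_radical ::
    "('r, 's) ring_scheme \<Rightarrow> ('v, 'e) pre_digraph \<Rightarrow> (('v, 'e) qpath \<Rightarrow> 'r) set \<Rightarrow> bool"
  where "arrow_radical R Q I \<longleftrightarrow>
    (let \<Lambda> = quiver_algebra R Q I; e = vertex_coset R Q I; \<alpha> = arrow_coset R Q I in
      \<forall>v \<in> verts Q.
        local_module (left_ideal \<Lambda>) (carrier \<Lambda> #>\<^bsub>\<Lambda>\<^esub> e v) \<and>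
        module_rad (left_ideal \<Lambda>) (carrier \<Lambda> #>\<^bsub>\<Lambda>\<^esub> e v) = left_sum \<Lambda> \<alpha> (out_arcs Q v) \<and>
        local_module (right_ideal \<Lambda>) (e v <#\<^bsub>\<Lambda>\<^esub> carrier \<Lambda>) \<and>
        module_rad (right_ideal \<Lambda>) (e v <#\<^bsub>\<Lambda>\<^esub> carrier \<Lambda>) = right_sum \<Lambda> \<alpha> (in_arcs Q v))"

definition arrow_direct ::
    "('r, 's) ring_scheme \<Rightarrow> ('v, 'e) pre_digraph \<Rightarrow> (('v, 'e) qpath \<Rightarrow> 'r) set \<Rightarrow> bool"
  where "arrow_direct R Q I \<longleftrightarrow>
    (let \<Lambda> = quiver_algebra R Q I; \<alpha> = arrow_coset R Q I in
      \<forall>a \<in> arcs Q.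
        (carrier \<Lambda> #>\<^bsub>\<Lambda>\<^esub> \<alpha> a) \<inter> left_sum \<Lambda> \<alpha> (out_arcs Q (tail Q a) - {a}) = {\<zero>\<^bsub>\<Lambda>\<^esub>} \<and>
        (\<alpha> a <#\<^bsub>\<Lambda>\<^esub> carrier \<Lambda>) \<inter> right_sum \<Lambda> \<alpha> (in_arcs Q (head Q a) - {a}) = {\<zero>\<^bsub>\<Lambda>\<^esub>})"

definition permissible ::
    "('r, 's) ring_scheme \<Rightarrow> ('v, 'e) pre_digraph \<Rightarrow> (('v, 'e) qpath \<Rightarrow> 'r) set \<Rightarrow> bool"
  where "permissible R Q I \<longleftrightarrow> (\<forall>a \<in> arcs Q. arrow_elem R Q a \<notin> I)"

definition special ::
    "('r, 's) ring_scheme \<Rightarrow> ('v, 'e) pre_digraph \<Rightarrow> (('v, 'e) qpath \<Rightarrow> 'r) set \<Rightarrow> bool"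
  where "special R Q I \<longleftrightarrow>
    (\<forall>b \<in> arcs Q.
      (\<exists>\<^sub>\<le>\<^sub>1 a. a \<in> arcs Q \<and> tail Q a = head Q b \<and>
        arrow_elem R Q a \<otimes>\<^bsub>path_algebra R Q\<^esub> arrow_elem R Q b \<notin> I) \<and>
      (\<exists>\<^sub>\<le>\<^sub>1 c. c \<in> arcs Q \<and> head Q c = tail Q b \<and>
        arrow_elem R Q b \<otimes>\<^bsub>path_algebra R Q\<^esub> arrow_elem R Q c \<notin> I))"

definition string_algebra ::
    "('r, 's) ring_scheme \<Rightarrow> ('v, 'e) pre_digraph \<Rightarrow> (('v, 'e) qpath \<Rightarrow> 'r) set \<Rightarrow> bool"
  where "string_algebra R Q I \<longleftrightarrow>
    commutative_noetherian_local_ring R \<and> fin_digraph Q \<and> ideal I (path_algebra R Q) \<and>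
    finitely_generated_module R (quiver_algebra R Q I) \<and>
    at_most_two_heads_and_tails Q \<and>
    arrow_radical R Q I \<and> arrow_direct R Q I \<and> permissible R Q I \<and> special R Q I"


section \<open>String algebras in the sense of Butler and Ringel\<close>

definition generated_by_long_paths ::
    "('r, 's) ring_scheme \<Rightarrow> ('v, 'e) pre_digraph \<Rightarrow> (('v, 'e) qpath \<Rightarrow> 'r) set \<Rightarrow> bool"
  where "generated_by_long_paths R Q I \<longleftrightarrow>
    (\<exists>P \<subseteq> {p \<in> qpaths Q. 2 \<le> path_length p}.
      I = genideal (path_algebra R Q) (path_elem R ` P))"

definition arrowwise_bounded ::
    "('r, 's) ring_scheme \<Rightarrow> ('v, 'e) pre_digraph \<Rightarrow> (('v, 'e) qpath \<Rightarrow> 'r) set \<Rightarrow> bool"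
  where "arrowwise_bounded R Q I \<longleftrightarrow>
    (\<forall>b \<in> arcs Q. \<exists>n. \<forall>p \<in> qpaths Q. n \<le> path_length p \<and> snd p \<noteq> [] \<and>
      (hd (snd p) = b \<or> last (snd p) = b) \<longrightarrow> path_elem R p \<in> I)"

definition butler_ringel_string_algebra ::
    "('r, 's) ring_scheme \<Rightarrow> ('v, 'e) pre_digraph \<Rightarrow> (('v, 'e) qpath \<Rightarrow> 'r) set \<Rightarrow> bool"
  where "butler_ringel_string_algebra k Q I \<longleftrightarrow>
    field k \<and> fin_digraph Q \<and> ideal I (path_algebra k Q) \<and>
    generated_by_long_paths k Q I \<and>
    at_most_two_heads_and_tails Q \<and> special k Q I \<and> arrowwise_bounded k Q I"

end

theory Submission
  imports Defs "HOL-Library.Infinite_Set"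
begin

text \<open>Beyond what the two notions share, both say the following: \<open>I\<close> is monomial, that is, every path in the
  support of an element of \<open>I\<close> lies in \<open>I\<close>, it contains only paths of length at least 2, and it
  contains all but finitely many paths.

  For a Butler--Ringel string algebra the ideal is monomial by construction, which gives
  arrow-directness; if all paths of length at least \<open>n\<close> vanish, then a submodule of \<open>\<Lambda>e\<^sub>v\<close>
  containing some \<open>c e\<^sub>v + j\<close> with \<open>c \<noteq> 0\<close> and \<open>j\<close> a combination of nontrivial paths contains all
  paths starting at \<open>v\<close>, by descending induction on their length, so it is all of \<open>\<Lambda>e\<^sub>v\<close>.

  Conversely, if \<open>\<Lambda>e\<^sub>v\<close> is local with radical spanned by the nontrivial paths, then \<open>c e\<^sub>v + j\<close>
  generates \<open>\<Lambda>e\<^sub>v\<close>, hence \<open>(c e\<^sub>v + j) p \<in> I\<close> implies \<open>p \<in> I\<close>. By arrow-directness it suffices to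
  treat \<open>f \<in> I\<close> whose paths all have the same first arrow. As \<open>I\<close> is special, the paths outside
  \<open>I\<close> with this first arrow extend one another, so modulo paths in \<open>I\<close> we have \<open>f = (c e\<^sub>v + j) p\<close>
  with \<open>p\<close> the shortest one, and \<open>I\<close> is monomial. As \<open>\<Lambda>\<close> is finite-dimensional, infinitely many
  paths outside \<open>I\<close> would have a nonzero combination in \<open>I\<close>, which monomiality excludes.\<close>

section \<open>One-sided ideals\<close>

context ring
begin

text \<open>\<open>\<ominus> x\<close> is \<open>(\<ominus> \<one>) \<otimes> x\<close>, so closure
  under left multiplication supplies the inverses that an additive subgroup requires.\<close>

lemma left_idealI:
  assumes "N \<subseteq> carrier R" "\<zero> \<in> N" "\<And>x y. x \<in> N \<Longrightarrow> y \<in> N \<Longrightarrow> x \<oplus> y \<in> N"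
    and "\<And>a x. a \<in> carrier R \<Longrightarrow> x \<in> N \<Longrightarrow> a \<otimes> x \<in> N"
  shows "left_ideal R N"
proof -
  have "\<ominus> x \<in> N" if "x \<in> N" for x
  proof -
    have "x \<in> carrier R" using that assms(1) by blast
    hence "\<ominus> x = (\<ominus> \<one>) \<otimes> x" by (simp add: l_minus)
    thus ?thesis using assms(4)[OF _ that, of "\<ominus> \<one>"] by simp
  qed
  hence "subgroup N (add_monoid R)"
    using assms by (intro add.subgroupI) (auto simp: a_inv_def)
  thus ?thesis
    using assms(4) by (auto simp: left_ideal_def intro: additive_subgroup.intro)
qed

lemma right_idealI:
  assumes "N \<subseteq> carrier R" "\<zero> \<in> N" "\<And>x y. x \<in> N \<Longrightarrow> y \<in> N \<Longrightarrow> x \<oplus> y \<in> N"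
    and "\<And>a x. a \<in> carrier R \<Longrightarrow> x \<in> N \<Longrightarrow> x \<otimes> a \<in> N"
  shows "right_ideal R N"
proof -
  have "\<ominus> x \<in> N" if "x \<in> N" for x
  proof -
    have "x \<in> carrier R" using that assms(1) by blast
    hence "\<ominus> x = x \<otimes> (\<ominus> \<one>)" by (simp add: r_minus)
    thus ?thesis using assms(4)[OF _ that, of "\<ominus> \<one>"] by simp
  qed
  hence "subgroup N (add_monoid R)"
    using assms by (intro add.subgroupI) (auto simp: a_inv_def)
  thus ?thesis
    using assms(4) by (auto simp: right_ideal_def intro: additive_subgroup.intro)
qed

lemma left_idealD:
  assumes "left_ideal R N"
  shows "N \<subseteq> carrier R" "\<zero> \<in> N" "x \<in> N \<Longrightarrow> y \<in> N \<Longrightarrow> x \<oplus> y \<in> N"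
    and "a \<in> carrier R \<Longrightarrow> x \<in> N \<Longrightarrow> a \<otimes> x \<in> N"
  using assms additive_subgroup.a_subset[of N R] additive_subgroup.zero_closed[of N R]
    additive_subgroup.a_closed[of N R]
  by (auto simp: left_ideal_def)

lemma right_idealD:
  assumes "right_ideal R N"
  shows "N \<subseteq> carrier R" "\<zero> \<in> N" "x \<in> N \<Longrightarrow> y \<in> N \<Longrightarrow> x \<oplus> y \<in> N"
    and "a \<in> carrier R \<Longrightarrow> x \<in> N \<Longrightarrow> x \<otimes> a \<in> N"
  using assms additive_subgroup.a_subset[of N R] additive_subgroup.zero_closed[of N R]
    additive_subgroup.a_closed[of N R]
  by (auto simp: right_ideal_def)

text \<open>As a coset of the whole carrier under multiplication, \<open>carrier R #> x\<close> is
  the cyclic left module \<open>Rx\<close>.\<close>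

lemma left_ideal_r_coset:
  assumes "x \<in> carrier R"
  shows "left_ideal R (carrier R #> x)"
proof (rule left_idealI)
  show "carrier R #> x \<subseteq> carrier R" using assms by (auto simp: r_coset_def)
  show "\<zero> \<in> carrier R #> x" using assms by (auto simp: r_coset_def intro!: bexI[of _ \<zero>])
  fix y assume "y \<in> carrier R #> x"
  then obtain b where b: "b \<in> carrier R" "y = b \<otimes> x" by (auto simp: r_coset_def)
  show "a \<otimes> y \<in> carrier R #> x" if "a \<in> carrier R" for a
    using that b assms by (auto simp: r_coset_def m_assoc[symmetric] intro!: bexI[of _ "a \<otimes> b"])
  fix z assume "z \<in> carrier R #> x"
  then obtain c where c: "c \<in> carrier R" "z = c \<otimes> x" by (auto simp: r_coset_def)
  show "y \<oplus> z \<in> carrier R #> x"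
    using b c assms by (auto simp: r_coset_def l_distr[symmetric] intro!: bexI[of _ "b \<oplus> c"])
qed

section \<open>Maximal submodules of cyclic left modules\<close>

lemma left_ideal_Union_chain:
  assumes "C \<noteq> {}" "subset.chain (Collect (left_ideal R)) C"
  shows "left_ideal R (\<Union>C)"
proof (rule left_idealI)
  have C: "left_ideal R N" if "N \<in> C" for N
    using assms(2) that by (auto simp: subset.chain_def)
  show "\<Union>C \<subseteq> carrier R" using left_idealD(1)[OF C] by blast
  show "\<zero> \<in> \<Union>C" using left_idealD(2)[OF C] assms(1) by blast
  show "a \<otimes> x \<in> \<Union>C" if "a \<in> carrier R" "x \<in> \<Union>C" for a x
    using left_idealD(4)[OF C that(1)] that(2) by blast
  fix x y assume "x \<in> \<Union>C" "y \<in> \<Union>C"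
  then obtain N M where NM: "N \<in> C" "M \<in> C" "x \<in> N" "y \<in> M" by blast
  hence "N \<subseteq> M \<or> M \<subseteq> N" using assms(2) by (auto simp: subset.chain_def)
  thus "x \<oplus> y \<in> \<Union>C"
    using NM left_idealD(3)[OF C[OF NM(1)]] left_idealD(3)[OF C[OF NM(2)]] by blast
qed

text \<open>A submodule of the cyclic module \<open>Re\<close> is proper exactly if it avoids the
  generator \<open>e\<close>. Avoiding \<open>e\<close> is preserved by unions of chains, so Zorn's
  lemma applies to the submodules that contain \<open>B\<close> and avoid \<open>e\<close>, and a
  maximal one among these is a maximal submodule of \<open>Re\<close>.\<close>

lemma maximal_left_submodule_exists:
  assumes e: "e \<in> carrier R" and B: "left_ideal R B" "B \<subseteq> carrier R #> e" "e \<notin> B"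
  obtains N where "maximal_submodule (left_ideal R) (carrier R #> e) N" "B \<subseteq> N"
proof -
  define S where "S = {N. left_ideal R N \<and> B \<subseteq> N \<and> N \<subseteq> carrier R #> e \<and> e \<notin> N}"
  have "\<exists>M\<in>S. \<forall>X\<in>S. M \<subseteq> X \<longrightarrow> X = M"
  proof (rule subset_Zorn_nonempty)
    show "S \<noteq> {}" using B by (auto simp: S_def)
    fix C assume C: "C \<noteq> {}" "subset.chain S C"
    hence "subset.chain (Collect (left_ideal R)) C" by (auto simp: subset.chain_def S_def)
    from left_ideal_Union_chain[OF C(1) this] show "\<Union>C \<in> S"
      using C by (auto simp: S_def subset.chain_def)
  qed
  then obtain N where N: "N \<in> S" "\<And>X. X \<in> S \<Longrightarrow> N \<subseteq> X \<Longrightarrow> X = N" by blast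
  have eM: "e \<in> carrier R #> e" using e by (auto simp: r_coset_def intro!: bexI[of _ \<one>])
  have "maximal_submodule (left_ideal R) (carrier R #> e) N"
    unfolding maximal_submodule_def
  proof (intro conjI allI impI)
    show "left_ideal R N" "N \<subset> carrier R #> e" using N(1) eM by (auto simp: S_def)
    fix N' assume N': "left_ideal R N' \<and> N \<subseteq> N' \<and> N' \<subseteq> carrier R #> e"
    show "N' = N \<or> N' = carrier R #> e"
    proof (cases "e \<in> N'")
      case True
      hence "carrier R #> e \<subseteq> N'" using left_idealD(4)[of N'] N' by (auto simp: r_coset_def)
      thus ?thesis using N' by blast
    next
      case False
      hence "N' \<in> S" using N' N(1) by (auto simp: S_def)
      thus ?thesis using N(2) N' by blast
    qed
  qed
  thus thesis using that N(1) by (auto simp: S_def)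
qed

text \<open>If \<open>Rx\<close> missed \<open>e\<close>, it would lie in a maximal submodule;
  locality makes that submodule the only one, hence equal to the radical, which does not contain
  \<open>x\<close>.\<close>

lemma local_left_module_generator:
  assumes e: "e \<in> carrier R" and loc: "local_module (left_ideal R) (carrier R #> e)"
    and x: "x \<in> carrier R #> e" "x \<notin> module_rad (left_ideal R) (carrier R #> e)"
  shows "e \<in> carrier R #> x"
proof (rule ccontr)
  assume ne: "e \<notin> carrier R #> x"
  have xR: "x \<in> carrier R" using x(1) e by (auto simp: r_coset_def)
  note li = left_ideal_r_coset[OF xR]
  have "carrier R #> x \<subseteq> carrier R #> e"
    using left_idealD(4)[OF left_ideal_r_coset[OF e] _ x(1)] by (auto simp: r_coset_def)
  then obtain N where N: "maximal_submodule (left_ideal R) (carrier R #> e) N" "carrier R #> x \<subseteq> N"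
    using maximal_left_submodule_exists[OF e li _ ne] by blast
  have "x \<in> carrier R #> x" using xR by (auto simp: r_coset_def intro!: bexI[of _ \<one>])
  hence "x \<in> N" using N(2) by blast
  moreover have "{N. maximal_submodule (left_ideal R) (carrier R #> e) N} = {N}"
    using loc N(1) unfolding local_module_def by auto
  ultimately show False using x by (simp add: module_rad_def)
qed

text \<open>Locality provides a maximal submodule, and a proper submodule cannot contain the
  generator. Without a maximal submodule the intersection in \<open>module_rad\<close> would be the
  whole module.\<close>

lemma generator_notin_local_rad:
  assumes e: "e \<in> carrier R" and loc: "local_module (left_ideal R) (carrier R #> e)"
  shows "e \<notin> module_rad (left_ideal R) (carrier R #> e)"
proof
  assume er: "e \<in> module_rad (left_ideal R) (carrier R #> e)"
  obtain N where N: "maximal_submodule (left_ideal R) (carrier R #> e) N"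
    using loc by (auto simp: local_module_def)
  hence "e \<in> N" using er by (auto simp: module_rad_def)
  hence "carrier R #> e \<subseteq> N"
    using left_idealD(4)[of N] N by (auto simp: r_coset_def maximal_submodule_def)
  thus False using N by (auto simp: maximal_submodule_def)
qed

text \<open>Splitting off one summand is what allows sums of principal left ideals to be computed by
  induction on the index set.\<close>

lemma left_sum_insert:
  assumes "finite S" "a \<notin> S" "\<And>i. i \<in> insert a S \<Longrightarrow> x i \<in> carrier R"
  shows "left_sum R x (insert a S) =
    {c \<otimes> x a \<oplus> y | c y. c \<in> carrier R \<and> y \<in> left_sum R x S}"
proof (intro equalityI subsetI)
  fix z assume "z \<in> left_sum R x (insert a S)"
  then obtain c where c: "c \<in> insert a S \<rightarrow> carrier R" "z = (\<Oplus>i\<in>insert a S. c i \<otimes> x i)"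
    by (auto simp: left_sum_def)
  have "z = c a \<otimes> x a \<oplus> (\<Oplus>i\<in>S. c i \<otimes> x i)"
    unfolding c(2) using assms c(1) by (intro finsum_insert) (auto simp: Pi_def)
  thus "z \<in> {c \<otimes> x a \<oplus> y | c y. c \<in> carrier R \<and> y \<in> left_sum R x S}"
    using c(1) unfolding left_sum_def by blast
next
  fix z assume "z \<in> {c \<otimes> x a \<oplus> y | c y. c \<in> carrier R \<and> y \<in> left_sum R x S}"
  then obtain c d where c: "c \<in> carrier R" "d \<in> S \<rightarrow> carrier R"
      "z = c \<otimes> x a \<oplus> (\<Oplus>i\<in>S. d i \<otimes> x i)"
    by (auto simp: left_sum_def)
  \<comment> \<open>The two coefficient families are merged; since \<open>a \<notin> S\<close>,
    overwriting at \<open>a\<close> leaves the sum over \<open>S\<close> unchanged.\<close>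
  let ?d = "d(a := c)"
  have "(\<Oplus>i\<in>insert a S. ?d i \<otimes> x i) = ?d a \<otimes> x a \<oplus> (\<Oplus>i\<in>S. ?d i \<otimes> x i)"
    using assms c by (intro finsum_insert) (auto simp: Pi_def)
  also have "(\<Oplus>i\<in>S. ?d i \<otimes> x i) = (\<Oplus>i\<in>S. d i \<otimes> x i)"
    using assms c by (intro finsum_cong') (auto simp: Pi_def)
  finally have "z = (\<Oplus>i\<in>insert a S. ?d i \<otimes> x i)" using c(3) by simp
  moreover have "?d \<in> insert a S \<rightarrow> carrier R" using c by auto
  ultimately show "z \<in> left_sum R x (insert a S)" unfolding left_sum_def by blast
qed

lemma right_sum_insert:
  assumes "finite S" "a \<notin> S" "\<And>i. i \<in> insert a S \<Longrightarrow> x i \<in> carrier R"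
  shows "right_sum R x (insert a S) =
    {x a \<otimes> c \<oplus> y | c y. c \<in> carrier R \<and> y \<in> right_sum R x S}"
proof (intro equalityI subsetI)
  fix z assume "z \<in> right_sum R x (insert a S)"
  then obtain c where c: "c \<in> insert a S \<rightarrow> carrier R" "z = (\<Oplus>i\<in>insert a S. x i \<otimes> c i)"
    by (auto simp: right_sum_def)
  have "z = x a \<otimes> c a \<oplus> (\<Oplus>i\<in>S. x i \<otimes> c i)"
    unfolding c(2) using assms c(1) by (intro finsum_insert) (auto simp: Pi_def)
  thus "z \<in> {x a \<otimes> c \<oplus> y | c y. c \<in> carrier R \<and> y \<in> right_sum R x S}"
    using c(1) unfolding right_sum_def by blast
next
  fix z assume "z \<in> {x a \<otimes> c \<oplus> y | c y. c \<in> carrier R \<and> y \<in> right_sum R x S}"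
  then obtain c d where c: "c \<in> carrier R" "d \<in> S \<rightarrow> carrier R"
      "z = x a \<otimes> c \<oplus> (\<Oplus>i\<in>S. x i \<otimes> d i)"
    by (auto simp: right_sum_def)
  let ?d = "d(a := c)"
  have "(\<Oplus>i\<in>insert a S. x i \<otimes> ?d i) = x a \<otimes> ?d a \<oplus> (\<Oplus>i\<in>S. x i \<otimes> ?d i)"
    using assms c by (intro finsum_insert) (auto simp: Pi_def)
  also have "(\<Oplus>i\<in>S. x i \<otimes> ?d i) = (\<Oplus>i\<in>S. x i \<otimes> d i)"
    using assms c by (intro finsum_cong') (auto simp: Pi_def)
  finally have "z = (\<Oplus>i\<in>insert a S. x i \<otimes> ?d i)" using c(3) by simp
  moreover have "?d \<in> insert a S \<rightarrow> carrier R" using c by auto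
  ultimately show "z \<in> right_sum R x (insert a S)" unfolding right_sum_def by blast
qed

end

text \<open>A maximal submodule cannot be all of \<open>M\<close>, so it lies in \<open>J\<close>,
  and as \<open>J\<close> is proper too, maximality forces equality. Conversely \<open>J\<close> is
  maximal, because a submodule above \<open>J\<close> is either inside \<open>J\<close> or all of
  \<open>M\<close>.\<close>

lemma local_moduleI:
  assumes "sub J" "J \<subset> M" "\<And>N. sub N \<Longrightarrow> N \<subseteq> M \<Longrightarrow> \<not> N \<subseteq> J \<Longrightarrow> N = M"
  shows "local_module sub M" "module_rad sub M = J"
proof -
  have "maximal_submodule sub M N \<longleftrightarrow> N = J" for N
    using assms unfolding maximal_submodule_def by blast
  thus "local_module sub M" "module_rad sub M = J"
    using assms(2) by (auto simp: local_module_def module_rad_def)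
qed

text \<open>A field has only the zero ideal and the unit ideal; both are principal, and the zero
  ideal is the only proper one.\<close>

lemma (in field) commutative_noetherian_local_ring: "commutative_noetherian_local_ring R"
  unfolding commutative_noetherian_local_ring_def
proof (intro conjI ex1I)
  show "cring R" by (rule is_cring)
  show "noetherian_ring R"
  proof (rule noetherian_ringI)
    fix I assume "ideal I R"
    hence "I = {\<zero>} \<or> I = carrier R" using all_ideals by blast
    hence "I = Idl {\<zero>} \<or> I = Idl {\<one>}" by (simp add: genideal_zero genideal_one)
    thus "\<exists>A\<subseteq>carrier R. finite A \<and> I = Idl A"
      by (metis empty_subsetI finite.emptyI finite.insertI insert_subset one_closed zero_closed)
  qed
  show "maximalideal {\<zero>} R" by (rule zeromaximalideal)
  show "M = {\<zero>}" if "maximalideal M R" for M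
  proof -
    interpret M: maximalideal M R by fact
    show ?thesis using all_ideals M.is_ideal M.I_notcarr by blast
  qed
qed

section \<open>Spans of paths\<close>

context quiver_path_algebra
begin

section \<open>Cutting a path into pieces\<close>

lemma path_append_iff:
  "(u, as @ bs) \<in> qpaths Q \<longleftrightarrow> (u, as) \<in> qpaths Q \<and> (path_target Q (u, as), bs) \<in> qpaths Q"
  by (auto simp: path_iff path_target_def Q.awlast_append)

lemma path_Nil_iff [simp]: "(u, []) \<in> qpaths Q \<longleftrightarrow> u \<in> verts Q"
  by (simp add: path_iff path_target_def Q.awalk_Nil_iff)

lemma path_Cons_iff:
  "(u, a # as) \<in> qpaths Q \<longleftrightarrow> a \<in> arcs Q \<and> u = tail Q a \<and> (head Q a, as) \<in> qpaths Q"
  by (auto simp: path_iff path_target_def Q.awalk_Cons_iff)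

lemma target_Nil [simp]: "path_target Q (u, []) = u"
  by (simp add: path_target_def)

lemma target_Cons [simp]: "path_target Q (u, a # as) = path_target Q (head Q a, as)"
  by (simp add: path_target_def)

lemma target_append [simp]:
  "path_target Q (u, as @ bs) = path_target Q (path_target Q (u, as), bs)"
  by (simp add: path_target_def Q.awlast_append)

lemma target_in_verts: "p \<in> qpaths Q \<Longrightarrow> path_target Q p \<in> verts Q"
  by (auto simp: path_iff dest: Q.awalk_last_in_verts)

lemma source_in_verts: "p \<in> qpaths Q \<Longrightarrow> fst p \<in> verts Q"
  by (auto simp: path_iff dest: Q.awalk_hd_in_verts)

lemma arrow_path_in: "a \<in> arcs Q \<Longrightarrow> arrow_path Q a \<in> qpaths Q"
  by (simp add: arrow_path_def path_Cons_iff)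

text \<open>Arrows are listed in the order of traversal, so the head of the list is the rightmost
  factor of the path, and the tail of the list is what multiplies it from the left.\<close>

lemma path_hd:
  assumes "p \<in> qpaths Q" "snd p \<noteq> []"
  shows "hd (snd p) \<in> arcs Q" "tail Q (hd (snd p)) = fst p"
    and "(head Q (hd (snd p)), tl (snd p)) \<in> qpaths Q"
    and "path_comp (head Q (hd (snd p)), tl (snd p)) (arrow_path Q (hd (snd p))) = p"
  using assms by (cases p; cases "snd p"; auto simp: path_Cons_iff path_comp_def arrow_path_def)+

lemma path_last:
  assumes "p \<in> qpaths Q" "snd p \<noteq> []"
  shows "last (snd p) \<in> arcs Q" "head Q (last (snd p)) = path_target Q p"
    and "(fst p, butlast (snd p)) \<in> qpaths Q"
    and "path_target Q (fst p, butlast (snd p)) = tail Q (last (snd p))"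
    and "path_comp (arrow_path Q (last (snd p))) (fst p, butlast (snd p)) = p"
  using assms
  by (cases p; cases "snd p" rule: rev_cases;
      auto simp: path_append_iff path_Cons_iff path_comp_def arrow_path_def)+

lemma mult_smult: assumes "r \<in> carrier R" "f \<in> carrier PA" "g \<in> carrier PA"
  shows "f \<otimes>\<^bsub>PA\<^esub> (r \<odot>\<^bsub>PA\<^esub> g) = r \<odot>\<^bsub>PA\<^esub> (f \<otimes>\<^bsub>PA\<^esub> g)"
  using assms carrierD(1)[OF assms(2)] carrierD(1)[OF assms(3)]
  by (auto simp: fun_eq_iff smult_eq mult_eq R.finsum_rdistr finite_F Pi_def R.m_lcomm
      intro!: R.finsum_cong')

text \<open>The span of the paths in \<open>X\<close> inside the free module. Elements of the path
  algebra vanish off \<open>qpaths Q\<close>, so \<open>X\<close> may contain pairs that are not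
  paths; this lets supports be given by simple conditions such as a prescribed first arrow.\<close>

definition path_span :: "('v, 'e) qpath set \<Rightarrow> (('v, 'e) qpath \<Rightarrow> 'r) set"
  where "path_span X = {f \<in> carrier PA. \<forall>p. f p \<noteq> \<zero> \<longrightarrow> p \<in> X}"

lemma path_spanI: "f \<in> carrier PA \<Longrightarrow> (\<And>p. p \<in> qpaths Q \<Longrightarrow> f p \<noteq> \<zero> \<Longrightarrow> p \<in> X) \<Longrightarrow> f \<in> path_span X"
  using carrierD(2)[of f] by (auto simp: path_span_def)

lemma path_spanD:
  assumes "f \<in> path_span X"
  shows "f \<in> carrier PA" "f p \<noteq> \<zero> \<Longrightarrow> p \<in> X" "p \<notin> X \<Longrightarrow> f p = \<zero>"
  using assms unfolding path_span_def mem_Collect_eq by metis+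

lemma path_span_mono: "f \<in> path_span X \<Longrightarrow> X \<inter> qpaths Q \<subseteq> Y \<Longrightarrow> f \<in> path_span Y"
  using carrierD(2)[of f] unfolding path_span_def by blast

lemma path_span_cong: "X \<inter> qpaths Q = Y \<inter> qpaths Q \<Longrightarrow> path_span X = path_span Y"
  using path_span_mono[of _ X Y] path_span_mono[of _ Y X] by blast

lemma path_span_zero: "\<zero>\<^bsub>PA\<^esub> \<in> path_span X"
  by (rule path_spanI) (auto simp: zero_closed zero_eq)

lemma path_span_add: "f \<in> path_span X \<Longrightarrow> g \<in> path_span X \<Longrightarrow> f \<oplus>\<^bsub>PA\<^esub> g \<in> path_span X"
  using carrierD(1)[of f] carrierD(1)[of g] 
  unfolding path_span_def mem_Collect_eq by (metis add_closed add_eq R.l_zero R.zero_closed)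

lemma path_span_smult: "r \<in> carrier R \<Longrightarrow> f \<in> path_span X \<Longrightarrow> r \<odot>\<^bsub>PA\<^esub> f \<in> path_span X"
  unfolding path_span_def mem_Collect_eq by (metis smult_closed smult_eq R.r_null)

lemma path_span_elem: "p \<in> qpaths Q \<Longrightarrow> p \<in> X \<Longrightarrow> path_elem R p \<in> path_span X"
  by (rule path_spanI, erule path_elem_closed) (simp add: path_elem_def split: if_splits)

lemma path_span_upd:
  assumes "f \<in> path_span X"
  shows "f(p := \<zero>) \<in> path_span (X - {p})"
proof (rule path_spanI)
  note f = path_spanD(1)[OF assms]
  show "f(p := \<zero>) \<in> carrier PA"
  proof (rule carrierI)
    show "finite {q. (f(p := \<zero>)) q \<noteq> \<zero>}"
      by (rule finite_subset[OF _ carrierD(3)[OF f]]) auto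
  qed (use carrierD[OF f] in auto)
  show "q \<in> X - {p}" if "(f(p := \<zero>)) q \<noteq> \<zero>" for q
    using that path_spanD(2)[OF assms, of q] by (auto split: if_splits)
qed

lemma path_split:
  assumes "f \<in> carrier PA" "p \<in> qpaths Q"
  shows "f = f p \<odot>\<^bsub>PA\<^esub> path_elem R p \<oplus>\<^bsub>PA\<^esub> f(p := \<zero>)"
  using assms carrierD(1)[OF assms(1)] by (auto simp: fun_eq_iff add_eq smult_eq path_elem_def)

text \<open>Induction on the size of the support: one path is peeled off by setting its coefficient
  to zero. This reduces statements that are closed under linear combinations to single
  paths.\<close>

lemma path_span_induct [consumes 1, case_names zero step]:
  assumes f: "f \<in> path_span X" and "P \<zero>\<^bsub>PA\<^esub>"
    and step: "\<And>g c p. g \<in> path_span X \<Longrightarrow> P g \<Longrightarrow> p \<in> X \<Longrightarrow> p \<in> qpaths Q \<Longrightarrow> c \<in> carrier R \<Longrightarrow>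
      P (c \<odot>\<^bsub>PA\<^esub> path_elem R p \<oplus>\<^bsub>PA\<^esub> g)"
  shows "P f"
  using f
proof (induction "card {p. f p \<noteq> \<zero>}" arbitrary: f rule: less_induct)
  case less
  note f = path_spanD(1)[OF less.prems]
  show ?case
  proof (cases "\<exists>p. f p \<noteq> \<zero>")
    case False
    hence "f = \<zero>\<^bsub>PA\<^esub>" by (auto simp: fun_eq_iff zero_eq)
    thus ?thesis using assms(2) by simp
  next
    case True
    then obtain p where p: "f p \<noteq> \<zero>" by blast
    have pQ: "p \<in> qpaths Q" using p carrierD(2)[OF f] by blast
    have up: "f(p := \<zero>) \<in> path_span X"
      using path_span_mono[OF path_span_upd[OF less.prems]] by blast
    have "card {q. (f(p := \<zero>)) q \<noteq> \<zero>} < card {q. f q \<noteq> \<zero>}"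
      by (rule psubset_card_mono[OF carrierD(3)[OF f]]) (use p in auto)
    from less.hyps[OF this up]
    have "P (f p \<odot>\<^bsub>PA\<^esub> path_elem R p \<oplus>\<^bsub>PA\<^esub> f(p := \<zero>))"
      by (intro step up) (use pQ p path_spanD(2)[OF less.prems] carrierD(1)[OF f] in auto)
    thus ?thesis using path_split[OF f pQ] by simp
  qed
qed

lemma path_span_restrict:
  assumes "f \<in> path_span (X \<union> Y)"
  obtains g h where "g \<in> path_span X" "h \<in> path_span (Y - X)" "f = g \<oplus>\<^bsub>PA\<^esub> h"
    "\<And>p. p \<in> X \<Longrightarrow> g p = f p" "\<And>p. p \<notin> X \<Longrightarrow> h p = f p"
proof -
  note f = path_spanD(1)[OF assms] and fXY = path_spanD(2)[OF assms]
  note c = carrierD[OF f]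
  define g h where "g = (\<lambda>p. if p \<in> X then f p else \<zero>)" and "h = (\<lambda>p. if p \<in> X then \<zero> else f p)"
  have fin: "finite {p. g p \<noteq> \<zero>}" "finite {p. h p \<noteq> \<zero>}"
    by (rule finite_subset[OF _ c(3)], simp add: g_def h_def subset_iff del: split_paired_All)+
  have "g \<in> carrier PA"
    by (rule carrierI[OF _ _ fin(1)]) (simp_all add: g_def c(1,2))
  moreover have "h \<in> carrier PA"
    by (rule carrierI[OF _ _ fin(2)]) (simp_all add: h_def c(1,2))
  moreover have "f = g \<oplus>\<^bsub>PA\<^esub> h" using c(1) by (auto simp: fun_eq_iff add_eq g_def h_def)
  moreover have "g \<in> path_span X" "h \<in> path_span (Y - X)"
    using calculation(1,2) fXY unfolding path_span_def g_def h_def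
    by (simp_all del: split_paired_All split: if_splits) (meson Un_iff)
  ultimately show thesis using that by (auto simp: g_def h_def)
qed

text \<open>The coefficient of the product at \<open>x\<close> is a sum over factorizations of
  \<open>x\<close>; if it is nonzero, some factorization has nonzero coefficients at both
  factors.\<close>

lemma path_span_mult:
  assumes "f \<in> path_span X" "g \<in> path_span Y"
    and "\<And>p q. p \<in> X \<Longrightarrow> q \<in> Y \<Longrightarrow> p \<in> qpaths Q \<Longrightarrow> q \<in> qpaths Q \<Longrightarrow>
      path_source p = path_target Q q \<Longrightarrow> path_comp p q \<in> Z"
  shows "f \<otimes>\<^bsub>PA\<^esub> g \<in> path_span Z"
proof (rule path_spanI)
  note f = path_spanD(1)[OF assms(1)] and g = path_spanD(1)[OF assms(2)]
  show "f \<otimes>\<^bsub>PA\<^esub> g \<in> carrier PA" using f g by (rule mult_closed)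
  fix x assume "(f \<otimes>\<^bsub>PA\<^esub> g) x \<noteq> \<zero>"
  hence "\<not> (\<forall>d\<in>F x. f (fst d) \<otimes> g (snd d) = \<zero>)"
    unfolding mult_eq using R.add.finprod_one_eqI[of "F x" "\<lambda>d. f (fst d) \<otimes> g (snd d)"] by auto
  then obtain d where d: "d \<in> F x" "f (fst d) \<otimes> g (snd d) \<noteq> \<zero>" by blast
  hence "f (fst d) \<noteq> \<zero>" "g (snd d) \<noteq> \<zero>"
    using R.l_null[OF carrierD(1)[OF g]] R.r_null[OF carrierD(1)[OF f]] by metis+
  thus "x \<in> Z"
    using d(1) assms(3)[of "fst d" "snd d"] path_spanD(2)[OF assms(1)] path_spanD(2)[OF assms(2)]
    by (auto simp: path_factorizations_def)
qed

text \<open>Each term \<open>c pq\<close> is \<open>(c p) q\<close>, and distributivity collects the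
  left factors into a single element supported on \<open>X\<close>.\<close>

lemma path_span_comp_right:
  assumes f: "f \<in> path_span {path_comp p q | p. p \<in> X \<and> p \<in> qpaths Q \<and> path_source p = path_target Q q}"
    and q: "q \<in> qpaths Q"
  shows "\<exists>g\<in>path_span X. f = g \<otimes>\<^bsub>PA\<^esub> path_elem R q"
  using f
proof (induction rule: path_span_induct)
  interpret A: ring PA by (rule ring_path_algebra)
  case zero
  show ?case
    by (rule bexI[of _ "\<zero>\<^bsub>PA\<^esub>"]) (use q in \<open>auto simp: path_span_zero path_elem_closed\<close>)
next
  interpret A: ring PA by (rule ring_path_algebra)
  case (step h c x)
  then obtain p g where p: "x = path_comp p q" "p \<in> X" "p \<in> qpaths Q" "path_source p = path_target Q q"
    and g: "g \<in> path_span X" "h = g \<otimes>\<^bsub>PA\<^esub> path_elem R q" by auto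
  let ?p = "c \<odot>\<^bsub>PA\<^esub> path_elem R p"
  have eq: "c \<odot>\<^bsub>PA\<^esub> path_elem R x = ?p \<otimes>\<^bsub>PA\<^esub> path_elem R q"
    using p q step by (simp add: smult_mult path_elem_closed path_elem_mult)
  have cl: "?p \<in> carrier PA" "path_elem R q \<in> carrier PA"
    using p q step by (simp_all add: smult_closed path_elem_closed)
  have "?p \<oplus>\<^bsub>PA\<^esub> g \<in> path_span X"
    using p g step by (auto intro!: path_span_add path_span_smult path_span_elem)
  moreover have "c \<odot>\<^bsub>PA\<^esub> path_elem R x \<oplus>\<^bsub>PA\<^esub> h = (?p \<oplus>\<^bsub>PA\<^esub> g) \<otimes>\<^bsub>PA\<^esub> path_elem R q"
    unfolding eq g(2) by (rule A.l_distr[symmetric, OF cl(1) path_spanD(1)[OF g(1)] cl(2)])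
  ultimately show ?case by blast
qed

lemma path_span_comp_left:
  assumes f: "f \<in> path_span {path_comp q p | p. p \<in> X \<and> p \<in> qpaths Q \<and> path_source q = path_target Q p}"
    and q: "q \<in> qpaths Q"
  shows "\<exists>g\<in>path_span X. f = path_elem R q \<otimes>\<^bsub>PA\<^esub> g"
  using f
proof (induction rule: path_span_induct)
  interpret A: ring PA by (rule ring_path_algebra)
  case zero
  show ?case
    by (rule bexI[of _ "\<zero>\<^bsub>PA\<^esub>"]) (use q in \<open>auto simp: path_span_zero path_elem_closed\<close>)
next
  interpret A: ring PA by (rule ring_path_algebra)
  case (step h c x)
  then obtain p g where p: "x = path_comp q p" "p \<in> X" "p \<in> qpaths Q" "path_source q = path_target Q p"
    and g: "g \<in> path_span X" "h = path_elem R q \<otimes>\<^bsub>PA\<^esub> g" by auto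
  let ?p = "c \<odot>\<^bsub>PA\<^esub> path_elem R p"
  have eq: "c \<odot>\<^bsub>PA\<^esub> path_elem R x = path_elem R q \<otimes>\<^bsub>PA\<^esub> ?p"
    using p q step by (simp add: mult_smult path_elem_closed path_elem_mult)
  have cl: "?p \<in> carrier PA" "path_elem R q \<in> carrier PA"
    using p q step by (simp_all add: smult_closed path_elem_closed)
  have "?p \<oplus>\<^bsub>PA\<^esub> g \<in> path_span X"
    using p g step by (auto intro!: path_span_add path_span_smult path_span_elem)
  moreover have "c \<odot>\<^bsub>PA\<^esub> path_elem R x \<oplus>\<^bsub>PA\<^esub> h = path_elem R q \<otimes>\<^bsub>PA\<^esub> (?p \<oplus>\<^bsub>PA\<^esub> g)"
    unfolding eq g(2) by (rule A.r_distr[symmetric, OF cl(1) path_spanD(1)[OF g(1)] cl(2)])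
  ultimately show ?case by blast
qed

text \<open>These supports describe one-sided modules of the path algebra: the left and the right
  module generated by \<open>e\<^sub>v\<close>, and the left and the right module generated by the
  arrows in \<open>S\<close>.\<close>

abbreviation "starting_at v \<equiv> {p :: ('v, 'e) qpath. fst p = v}"
abbreviation "ending_at v \<equiv> {p. path_target Q p = v}"
abbreviation "first_arrow_in S \<equiv> {p :: ('v, 'e) qpath. snd p \<noteq> [] \<and> hd (snd p) \<in> S}"
abbreviation "last_arrow_in S \<equiv> {p :: ('v, 'e) qpath. snd p \<noteq> [] \<and> last (snd p) \<in> S}"

section \<open>Multiples of arrows and of trivial paths\<close>

lemma path_span_first_arrow:
  assumes "f \<in> path_span (first_arrow_in {a})" "a \<in> arcs Q"
  shows "\<exists>g\<in>carrier PA. f = g \<otimes>\<^bsub>PA\<^esub> arrow_elem R Q a"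
proof -
  have "p \<in> {path_comp p (arrow_path Q a) | p.
      p \<in> UNIV \<and> p \<in> qpaths Q \<and> path_source p = path_target Q (arrow_path Q a)}"
    if "p \<in> first_arrow_in {a} \<inter> qpaths Q" for p
    unfolding mem_Collect_eq
    by (rule exI[of _ "(head Q a, tl (snd p))"])
      (use that path_hd[of p] in \<open>auto simp: path_source_def arrow_path_def\<close>)
  hence "f \<in> path_span {path_comp p (arrow_path Q a) | p.
      p \<in> UNIV \<and> p \<in> qpaths Q \<and> path_source p = path_target Q (arrow_path Q a)}"
    by (intro path_span_mono[OF assms(1)] subsetI)
  from path_span_comp_right[OF this arrow_path_in[OF assms(2)]] show ?thesis
    using path_spanD(1) by blast
qed

lemma path_span_last_arrow:
  assumes "f \<in> path_span (last_arrow_in {a})" "a \<in> arcs Q"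
  shows "\<exists>g\<in>carrier PA. f = arrow_elem R Q a \<otimes>\<^bsub>PA\<^esub> g"
proof -
  have "p \<in> {path_comp (arrow_path Q a) p | p.
      p \<in> UNIV \<and> p \<in> qpaths Q \<and> path_source (arrow_path Q a) = path_target Q p}"
    if "p \<in> last_arrow_in {a} \<inter> qpaths Q" for p
    unfolding mem_Collect_eq
    by (rule exI[of _ "(fst p, butlast (snd p))"])
      (use that path_last[of p] in \<open>auto simp: path_source_def arrow_path_def\<close>)
  hence "f \<in> path_span {path_comp (arrow_path Q a) p | p.
      p \<in> UNIV \<and> p \<in> qpaths Q \<and> path_source (arrow_path Q a) = path_target Q p}"
    by (intro path_span_mono[OF assms(1)] subsetI)
  from path_span_comp_left[OF this arrow_path_in[OF assms(2)]] show ?thesis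
    using path_spanD(1) by blast
qed

lemma path_span_arrow_right:
  assumes "g \<in> carrier PA" "a \<in> arcs Q"
  shows "g \<otimes>\<^bsub>PA\<^esub> arrow_elem R Q a \<in> path_span (first_arrow_in {a})"
proof (rule path_span_mult)
  show "g \<in> path_span UNIV" using assms by (auto simp: path_span_def)
  show "arrow_elem R Q a \<in> path_span {arrow_path Q a}"
    using assms by (intro path_span_elem) (auto simp: arrow_path_in)
qed (auto simp: path_comp_def arrow_path_def)

lemma path_span_arrow_left:
  assumes "g \<in> carrier PA" "a \<in> arcs Q"
  shows "arrow_elem R Q a \<otimes>\<^bsub>PA\<^esub> g \<in> path_span (last_arrow_in {a})"
proof (rule path_span_mult)
  show "g \<in> path_span UNIV" using assms by (auto simp: path_span_def)
  show "arrow_elem R Q a \<in> path_span {arrow_path Q a}"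
    using assms by (intro path_span_elem) (auto simp: arrow_path_in)
qed (auto simp: path_comp_def arrow_path_def)

lemma path_span_vertex_right:
  assumes "g \<in> carrier PA" "v \<in> verts Q"
  shows "g \<otimes>\<^bsub>PA\<^esub> path_elem R (trivial_path v) \<in> path_span (starting_at v)"
proof (rule path_span_mult)
  show "g \<in> path_span UNIV" using assms by (auto simp: path_span_def)
  show "path_elem R (trivial_path v) \<in> path_span {trivial_path v}"
    using assms by (intro path_span_elem) (auto simp: triv_path)
qed (auto simp: path_comp_def trivial_path_def)

lemma path_span_vertex_left:
  assumes "g \<in> carrier PA" "v \<in> verts Q"
  shows "path_elem R (trivial_path v) \<otimes>\<^bsub>PA\<^esub> g \<in> path_span (ending_at v)"
proof (rule path_span_mult)
  show "g \<in> path_span UNIV" using assms by (auto simp: path_span_def)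
  show "path_elem R (trivial_path v) \<in> path_span {trivial_path v}"
    using assms by (intro path_span_elem) (auto simp: triv_path)
qed (auto simp: path_comp_def trivial_path_def path_source_def)

lemma path_elem_vertex_right:
  assumes "p \<in> qpaths Q" "fst p = v"
  shows "path_elem R p \<otimes>\<^bsub>PA\<^esub> path_elem R (trivial_path v) = path_elem R p"
  using assms source_in_verts[OF assms(1)] triv_path[of v]
  by (simp add: path_elem_mult path_source_def trivial_path_def path_comp_def prod_eq_iff)
    (metis prod.collapse)

lemma path_elem_vertex_left:
  assumes "p \<in> qpaths Q" "path_target Q p = v"
  shows "path_elem R (trivial_path v) \<otimes>\<^bsub>PA\<^esub> path_elem R p = path_elem R p"
  using assms target_in_verts[OF assms(1)] triv_path[of v]
  by (simp add: path_elem_mult path_source_def trivial_path_def path_comp_def)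

lemma path_span_starting_at:
  assumes "f \<in> path_span (starting_at v)" "v \<in> verts Q"
  shows "f \<otimes>\<^bsub>PA\<^esub> path_elem R (trivial_path v) = f"
proof -
  interpret A: ring PA by (rule ring_path_algebra)
  note e = path_elem_closed[OF triv_path[OF assms(2)]]
  from assms(1) show ?thesis
  proof (induction rule: path_span_induct)
    case (step g c p)
    thus ?case using path_spanD(1)[OF step(1)] e
      by (simp add: A.l_distr smult_closed path_elem_closed smult_mult path_elem_vertex_right)
  qed (simp add: e)
qed

lemma path_span_ending_at:
  assumes "f \<in> path_span (ending_at v)" "v \<in> verts Q"
  shows "path_elem R (trivial_path v) \<otimes>\<^bsub>PA\<^esub> f = f"
proof -
  interpret A: ring PA by (rule ring_path_algebra)
  note e = path_elem_closed[OF triv_path[OF assms(2)]]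
  from assms(1) show ?thesis
  proof (induction rule: path_span_induct)
    case (step g c p)
    thus ?case using path_spanD(1)[OF step(1)] e
      by (simp add: A.r_distr smult_closed path_elem_closed mult_smult path_elem_vertex_left)
  qed (simp add: e)
qed

end

section \<open>Linear combinations in a module\<close>

context module
begin

text \<open>The set that occurs in \<open>finitely_generated_module\<close>, isolated for induction
  on the generators.\<close>

definition lin_combs :: "'c set \<Rightarrow> 'c set"
  where "lin_combs S = {\<Oplus>\<^bsub>M\<^esub>s\<in>S. c s \<odot>\<^bsub>M\<^esub> s | c. c \<in> S \<rightarrow> carrier R}"

lemma lin_combs_empty: "lin_combs {} = {\<zero>\<^bsub>M\<^esub>}"
  by (auto simp: lin_combs_def)

lemma lin_combs_insert:
  assumes "finite S" "t \<notin> S" "insert t S \<subseteq> carrier M"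
  shows "lin_combs (insert t S) = {c \<odot>\<^bsub>M\<^esub> t \<oplus>\<^bsub>M\<^esub> w | c w. c \<in> carrier R \<and> w \<in> lin_combs S}"
proof (intro equalityI subsetI)
  fix z assume "z \<in> lin_combs (insert t S)"
  then obtain c where c: "c \<in> insert t S \<rightarrow> carrier R" "z = (\<Oplus>\<^bsub>M\<^esub>s\<in>insert t S. c s \<odot>\<^bsub>M\<^esub> s)"
    by (auto simp: lin_combs_def)
  have "z = c t \<odot>\<^bsub>M\<^esub> t \<oplus>\<^bsub>M\<^esub> (\<Oplus>\<^bsub>M\<^esub>s\<in>S. c s \<odot>\<^bsub>M\<^esub> s)"
    unfolding c(2) using assms c(1) by (intro M.finsum_insert) (auto simp: Pi_def)
  thus "z \<in> {c \<odot>\<^bsub>M\<^esub> t \<oplus>\<^bsub>M\<^esub> w | c w. c \<in> carrier R \<and> w \<in> lin_combs S}"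
    using c(1) unfolding lin_combs_def by blast
next
  fix z assume "z \<in> {c \<odot>\<^bsub>M\<^esub> t \<oplus>\<^bsub>M\<^esub> w | c w. c \<in> carrier R \<and> w \<in> lin_combs S}"
  then obtain c d where c: "c \<in> carrier R" "d \<in> S \<rightarrow> carrier R"
      "z = c \<odot>\<^bsub>M\<^esub> t \<oplus>\<^bsub>M\<^esub> (\<Oplus>\<^bsub>M\<^esub>s\<in>S. d s \<odot>\<^bsub>M\<^esub> s)"
    by (auto simp: lin_combs_def)
  let ?d = "d(t := c)"
  have "(\<Oplus>\<^bsub>M\<^esub>s\<in>insert t S. ?d s \<odot>\<^bsub>M\<^esub> s) = ?d t \<odot>\<^bsub>M\<^esub> t \<oplus>\<^bsub>M\<^esub> (\<Oplus>\<^bsub>M\<^esub>s\<in>S. ?d s \<odot>\<^bsub>M\<^esub> s)"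
    using assms c by (intro M.finsum_insert) (auto simp: Pi_def)
  also have "(\<Oplus>\<^bsub>M\<^esub>s\<in>S. ?d s \<odot>\<^bsub>M\<^esub> s) = (\<Oplus>\<^bsub>M\<^esub>s\<in>S. d s \<odot>\<^bsub>M\<^esub> s)"
    using assms c by (intro M.finsum_cong') (auto simp: Pi_def)
  finally have "z = (\<Oplus>\<^bsub>M\<^esub>s\<in>insert t S. ?d s \<odot>\<^bsub>M\<^esub> s)" using c(3) by simp
  moreover have "?d \<in> insert t S \<rightarrow> carrier R" using c by auto
  ultimately show "z \<in> lin_combs (insert t S)" unfolding lin_combs_def by blast
qed

text \<open>The claims are carried through one induction on the generators, since they support each
  other: the new generator \<open>t\<close>, for instance, arises as \<open>t\<close> plus the zero
  combination of \<open>S\<close>.\<close>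

lemma lin_combs_closed:
  assumes "finite S" "S \<subseteq> carrier M"
  shows "lin_combs S \<subseteq> carrier M" "\<zero>\<^bsub>M\<^esub> \<in> lin_combs S" "S \<subseteq> lin_combs S"
    and "\<And>x y. x \<in> lin_combs S \<Longrightarrow> y \<in> lin_combs S \<Longrightarrow> x \<oplus>\<^bsub>M\<^esub> y \<in> lin_combs S"
    and "\<And>r x. r \<in> carrier R \<Longrightarrow> x \<in> lin_combs S \<Longrightarrow> r \<odot>\<^bsub>M\<^esub> x \<in> lin_combs S"
proof -
  have "lin_combs S \<subseteq> carrier M \<and> \<zero>\<^bsub>M\<^esub> \<in> lin_combs S \<and> S \<subseteq> lin_combs S \<and>
    (\<forall>x\<in>lin_combs S. \<forall>y\<in>lin_combs S. x \<oplus>\<^bsub>M\<^esub> y \<in> lin_combs S) \<and>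
    (\<forall>r\<in>carrier R. \<forall>x\<in>lin_combs S. r \<odot>\<^bsub>M\<^esub> x \<in> lin_combs S)" (is "?P S")
    using assms
  proof (induction S rule: finite_induct)
    case empty
    show ?case by (simp add: lin_combs_empty)
  next
    case (insert t S)
    let ?W = "lin_combs S"
    have IH: "?P S" and t: "t \<in> carrier M" using insert by simp_all
    have eq: "lin_combs (insert t S) = {c \<odot>\<^bsub>M\<^esub> t \<oplus>\<^bsub>M\<^esub> w | c w. c \<in> carrier R \<and> w \<in> ?W}"
      using insert by (intro lin_combs_insert) auto
    have I: "c \<odot>\<^bsub>M\<^esub> t \<oplus>\<^bsub>M\<^esub> w \<in> lin_combs (insert t S)" if "c \<in> carrier R" "w \<in> ?W" for c w
      unfolding eq using that by blast
    have W: "w \<in> carrier M" if "w \<in> ?W" for w using IH that by blast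
    have zero: "\<zero> \<odot>\<^bsub>M\<^esub> t \<oplus>\<^bsub>M\<^esub> w = w" if "w \<in> ?W" for w using t W[OF that] by simp
    show ?case
    proof (intro conjI ballI)
      show "lin_combs (insert t S) \<subseteq> carrier M" unfolding eq using t W by auto
      have WI: "w \<in> lin_combs (insert t S)" if "w \<in> ?W" for w
        using I[OF R.zero_closed that] zero[OF that] by simp
      show "\<zero>\<^bsub>M\<^esub> \<in> lin_combs (insert t S)" using WI IH by blast
      have "t \<in> lin_combs (insert t S)" using I[of \<one> "\<zero>\<^bsub>M\<^esub>"] t IH by simp
      moreover have "S \<subseteq> lin_combs (insert t S)" using WI IH by blast
      ultimately show "insert t S \<subseteq> lin_combs (insert t S)" by simp
    next
      fix x y assume "x \<in> lin_combs (insert t S)" "y \<in> lin_combs (insert t S)"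
      then obtain c v d w where *: "c \<in> carrier R" "d \<in> carrier R" "v \<in> ?W" "w \<in> ?W"
        "x = c \<odot>\<^bsub>M\<^esub> t \<oplus>\<^bsub>M\<^esub> v" "y = d \<odot>\<^bsub>M\<^esub> t \<oplus>\<^bsub>M\<^esub> w"
        unfolding eq by blast
      have "x \<oplus>\<^bsub>M\<^esub> y = (c \<oplus> d) \<odot>\<^bsub>M\<^esub> t \<oplus>\<^bsub>M\<^esub> (v \<oplus>\<^bsub>M\<^esub> w)"
        using * t W by (simp add: smult_l_distr M.a_ac)
      thus "x \<oplus>\<^bsub>M\<^esub> y \<in> lin_combs (insert t S)" using I * IH by simp
    next
      fix r x assume r: "r \<in> carrier R" and "x \<in> lin_combs (insert t S)"
      then obtain c v where *: "c \<in> carrier R" "v \<in> ?W" "x = c \<odot>\<^bsub>M\<^esub> t \<oplus>\<^bsub>M\<^esub> v"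
        unfolding eq by blast
      have "r \<odot>\<^bsub>M\<^esub> x = (r \<otimes> c) \<odot>\<^bsub>M\<^esub> t \<oplus>\<^bsub>M\<^esub> r \<odot>\<^bsub>M\<^esub> v"
        using * r t W by (simp add: smult_r_distr smult_assoc1)
      thus "r \<odot>\<^bsub>M\<^esub> x \<in> lin_combs (insert t S)" using I r * IH by simp
    qed
  qed
  thus "lin_combs S \<subseteq> carrier M" "\<zero>\<^bsub>M\<^esub> \<in> lin_combs S" "S \<subseteq> lin_combs S"
    "\<And>x y. x \<in> lin_combs S \<Longrightarrow> y \<in> lin_combs S \<Longrightarrow> x \<oplus>\<^bsub>M\<^esub> y \<in> lin_combs S"
    "\<And>r x. r \<in> carrier R \<Longrightarrow> x \<in> lin_combs S \<Longrightarrow> r \<odot>\<^bsub>M\<^esub> x \<in> lin_combs S"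
    by blast+
qed

lemma finitely_generated_module_iff:
  "finitely_generated_module R M \<longleftrightarrow>
    (\<exists>S. finite S \<and> S \<subseteq> carrier M \<and> carrier M = lin_combs S)"
  by (simp add: finitely_generated_module_def lin_combs_def)

end

section \<open>Quotients of path algebras\<close>

text \<open>\<open>quotient_algebra\<close> shares its ring operations with \<open>A Quot I\<close>
  and only adds the scalar multiplication, so the ring axioms carry over by unfolding.\<close>

lemma ring_quotient_algebra:
  assumes "ideal I A"
  shows "ring (quotient_algebra A I)"
proof -
  interpret B: ring "A Quot I" using assms by (rule ideal.quotient_is_ring)
  show ?thesis
  proof (rule ringI)
    show "abelian_group (quotient_algebra A I)"
    proof (rule abelian_groupI)
      fix x assume "x \<in> carrier (quotient_algebra A I)"
      thus "\<exists>y\<in>carrier (quotient_algebra A I). y \<oplus>\<^bsub>quotient_algebra A I\<^esub> x = \<zero>\<^bsub>quotient_algebra A I\<^esub>"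
        using B.l_neg[of x] by (auto simp: quotient_algebra_def intro!: bexI[of _ "\<ominus>\<^bsub>A Quot I\<^esub> x"])
    qed (auto simp: quotient_algebra_def B.a_ac)
    show "Group.monoid (quotient_algebra A I)"
      by (rule monoidI) (auto simp: quotient_algebra_def B.m_assoc)
  qed (auto simp: quotient_algebra_def B.l_distr B.r_distr)
qed

section \<open>The quotient map and scalars on the quotient\<close>

locale quiver_quotient = quiver_path_algebra R Q + A: ideal I "path_algebra R Q"
  for R :: "('r, 's) ring_scheme" (structure) and Q :: "('v, 'e) pre_digraph" and I
begin

abbreviation "L \<equiv> quiver_algebra R Q I"
abbreviation "cls f \<equiv> I +>\<^bsub>PA\<^esub> f"

sublocale L: ring L
  by (rule ring_quotient_algebra) (rule A.is_ideal)

lemma carrier_L: "carrier L = cls ` carrier PA"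
  by (auto simp: quotient_algebra_def FactRing_simps)

lemma cls_closed: "f \<in> carrier PA \<Longrightarrow> cls f \<in> carrier L"
  by (simp add: carrier_L)

lemma cls_hom:
  assumes "f \<in> carrier PA" "g \<in> carrier PA"
  shows "cls f \<otimes>\<^bsub>L\<^esub> cls g = cls (f \<otimes>\<^bsub>PA\<^esub> g)" "cls f \<oplus>\<^bsub>L\<^esub> cls g = cls (f \<oplus>\<^bsub>PA\<^esub> g)"
  using ring_hom_mult[OF A.rcos_ring_hom assms] ring_hom_add[OF A.rcos_ring_hom assms]
  by (simp_all add: quotient_algebra_def)

lemma cls_eq_zero_iff: "f \<in> carrier PA \<Longrightarrow> cls f = \<zero>\<^bsub>L\<^esub> \<longleftrightarrow> f \<in> I"
  using A.a_rcos_zero[OF A.is_ideal] A.rcos_const_imp_mem[of f]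
  by (auto simp: quotient_algebra_def FactRing_def)

lemma cls_zero: "cls \<zero>\<^bsub>PA\<^esub> = \<zero>\<^bsub>L\<^esub>"
  by (simp add: cls_eq_zero_iff)

lemma cls_eqD:
  assumes "f \<in> carrier PA" "cls f = cls g"
  obtains i where "i \<in> I" "f = i \<oplus>\<^bsub>PA\<^esub> g"
  using A.a_rcos_self[OF assms(1)] assms(2) unfolding a_r_coset_def' by auto

lemma cls_add_ideal:
  assumes "i \<in> I" "g \<in> carrier PA"
  shows "cls (i \<oplus>\<^bsub>PA\<^esub> g) = cls g"
proof -
  have i: "i \<in> carrier PA" using assms(1) by (rule A.Icarr)
  have "cls (i \<oplus>\<^bsub>PA\<^esub> g) = cls i \<oplus>\<^bsub>L\<^esub> cls g" by (simp only: cls_hom[OF i assms(2)])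
  also have "cls i = \<zero>\<^bsub>L\<^esub>" using assms(1) i by (simp only: cls_eq_zero_iff)
  finally show ?thesis using cls_closed[OF assms(2)] by simp
qed

text \<open>Scalar multiplication by \<open>c\<close> is ring multiplication by the scalar multiple
  \<open>c\<close> of the identity, and an ideal absorbs the latter.\<close>

lemma smult_in_ideal:
  assumes "c \<in> carrier R" "i \<in> I"
  shows "c \<odot>\<^bsub>PA\<^esub> i \<in> I"
proof -
  have i: "i \<in> carrier PA" using assms(2) by (rule A.Icarr)
  have "c \<odot>\<^bsub>PA\<^esub> i = (c \<odot>\<^bsub>PA\<^esub> \<one>\<^bsub>PA\<^esub>) \<otimes>\<^bsub>PA\<^esub> i"
    by (simp only: smult_mult[OF assms(1) one_closed i] one_mult(1)[OF i])
  thus ?thesis using A.I_l_closed[OF assms(2) smult_closed[OF assms(1) one_closed]] by (simp only:)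
qed

sublocale M: module R L
proof (rule moduleI[OF R.is_cring L.is_abelian_group])
  interpret P: module R PA by (rule module_path_algebra)
  note sc = smult_coset[OF A.is_ideal]
  fix x assume "x \<in> carrier L"
  then obtain f where f: "f \<in> carrier PA" "x = cls f" by (auto simp: carrier_L)
  show "\<one> \<odot>\<^bsub>L\<^esub> x = x" unfolding f(2) sc[OF R.one_closed f(1)] using f(1) by simp
  fix a assume a: "a \<in> carrier R"
  show ax: "a \<odot>\<^bsub>L\<^esub> x \<in> carrier L" unfolding f(2) sc[OF a f(1)] using f a by (simp add: cls_closed)
  show "a \<odot>\<^bsub>L\<^esub> (x \<oplus>\<^bsub>L\<^esub> y) = a \<odot>\<^bsub>L\<^esub> x \<oplus>\<^bsub>L\<^esub> a \<odot>\<^bsub>L\<^esub> y" if "y \<in> carrier L" for y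
  proof -
    obtain g where g: "g \<in> carrier PA" "y = cls g" using \<open>y \<in> carrier L\<close> by (auto simp: carrier_L)
    show ?thesis unfolding f(2) g(2)
      using f g a by (simp add: sc cls_hom P.smult_r_distr)
  qed
  fix b assume b: "b \<in> carrier R"
  show "(a \<oplus> b) \<odot>\<^bsub>L\<^esub> x = a \<odot>\<^bsub>L\<^esub> x \<oplus>\<^bsub>L\<^esub> b \<odot>\<^bsub>L\<^esub> x"
    unfolding f(2) using f a b by (simp add: sc cls_hom P.smult_l_distr)
  show "(a \<otimes> b) \<odot>\<^bsub>L\<^esub> x = a \<odot>\<^bsub>L\<^esub> (b \<odot>\<^bsub>L\<^esub> x)"
    unfolding f(2) using f a b by (simp add: sc cls_hom P.smult_assoc1)
qed

lemma smult_cls: "c \<in> carrier R \<Longrightarrow> f \<in> carrier PA \<Longrightarrow> c \<odot>\<^bsub>L\<^esub> cls f = cls (c \<odot>\<^bsub>PA\<^esub> f)"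
  by (rule smult_coset[OF A.is_ideal])

lemma path_elem_ideal_mult:
  assumes "path_elem R p \<in> I \<or> path_elem R q \<in> I" "p \<in> qpaths Q" "q \<in> qpaths Q"
    "path_source p = path_target Q q"
  shows "path_elem R (path_comp p q) \<in> I"
proof -
  have "path_elem R (path_comp p q) = path_elem R p \<otimes>\<^bsub>PA\<^esub> path_elem R q"
    using assms by (simp add: path_elem_mult)
  thus ?thesis
    using assms A.I_l_closed[of "path_elem R q" "path_elem R p"]
      A.I_r_closed[of "path_elem R p" "path_elem R q"] by (auto simp: path_elem_closed)
qed

lemma in_idealI:
  assumes "f \<in> carrier PA" "\<And>p. p \<in> qpaths Q \<Longrightarrow> f p \<noteq> \<zero> \<Longrightarrow> path_elem R p \<in> I"
  shows "f \<in> I"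
proof -
  have "f \<in> path_span {p. path_elem R p \<in> I}" using assms by (intro path_spanI) auto
  thus ?thesis
    by (induction rule: path_span_induct) (auto intro!: A.a_closed smult_in_ideal)
qed

section \<open>One-sided modules as images of spans of paths\<close>

lemma cls_path_span_left_ideal:
  assumes "\<And>f g. f \<in> carrier PA \<Longrightarrow> g \<in> path_span X \<Longrightarrow> f \<otimes>\<^bsub>PA\<^esub> g \<in> path_span X"
  shows "left_ideal L (cls ` path_span X)"
proof (rule L.left_idealI)
  show "cls ` path_span X \<subseteq> carrier L" using path_spanD(1) by (auto simp: carrier_L)
  show "\<zero>\<^bsub>L\<^esub> \<in> cls ` path_span X" using path_span_zero cls_zero by (metis imageI)
  show "x \<oplus>\<^bsub>L\<^esub> y \<in> cls ` path_span X" if "x \<in> cls ` path_span X" "y \<in> cls ` path_span X" for x y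
    using that path_span_add path_spanD(1) by (auto simp: cls_hom)
  show "x \<otimes>\<^bsub>L\<^esub> y \<in> cls ` path_span X" if "x \<in> carrier L" "y \<in> cls ` path_span X" for x y
    using that assms path_spanD(1) by (auto simp: cls_hom carrier_L)
qed

lemma cls_path_span_right_ideal:
  assumes "\<And>f g. f \<in> carrier PA \<Longrightarrow> g \<in> path_span X \<Longrightarrow> g \<otimes>\<^bsub>PA\<^esub> f \<in> path_span X"
  shows "right_ideal L (cls ` path_span X)"
proof (rule L.right_idealI)
  show "cls ` path_span X \<subseteq> carrier L" using path_spanD(1) by (auto simp: carrier_L)
  show "\<zero>\<^bsub>L\<^esub> \<in> cls ` path_span X" using path_span_zero cls_zero by (metis imageI)
  show "x \<oplus>\<^bsub>L\<^esub> y \<in> cls ` path_span X" if "x \<in> cls ` path_span X" "y \<in> cls ` path_span X" for x y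
    using that path_span_add path_spanD(1) by (auto simp: cls_hom)
  show "y \<otimes>\<^bsub>L\<^esub> x \<in> cls ` path_span X" if "x \<in> carrier L" "y \<in> cls ` path_span X" for x y
    using that assms path_spanD(1) by (auto simp: cls_hom carrier_L)
qed

text \<open>In the path algebra, right multiplication by the trivial path lands in the span of the
  paths starting at \<open>v\<close> and fixes that span; the quotient map transports both
  facts.\<close>

lemma vertex_left_module:
  assumes "v \<in> verts Q"
  shows "carrier L #>\<^bsub>L\<^esub> vertex_coset R Q I v = cls ` path_span (starting_at v)"
proof (intro equalityI subsetI)
  note e = path_elem_closed[OF triv_path[OF assms]]
  fix x assume "x \<in> carrier L #>\<^bsub>L\<^esub> vertex_coset R Q I v"
  then obtain f where f: "f \<in> carrier PA" "x = cls f \<otimes>\<^bsub>L\<^esub> cls (path_elem R (trivial_path v))"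
    by (auto simp: r_coset_def vertex_coset_def carrier_L)
  thus "x \<in> cls ` path_span (starting_at v)"
    using path_span_vertex_right[OF f(1) assms] e by (simp add: cls_hom)
next
  note e = path_elem_closed[OF triv_path[OF assms]]
  fix x assume "x \<in> cls ` path_span (starting_at v)"
  then obtain f where f: "f \<in> path_span (starting_at v)" "x = cls f" by blast
  have "x = cls f \<otimes>\<^bsub>L\<^esub> cls (path_elem R (trivial_path v))"
    unfolding f(2) cls_hom(1)[OF path_spanD(1)[OF f(1)] e] path_span_starting_at[OF f(1) assms] ..
  thus "x \<in> carrier L #>\<^bsub>L\<^esub> vertex_coset R Q I v"
    using cls_closed[OF path_spanD(1)[OF f(1)]] by (auto simp: r_coset_def vertex_coset_def)
qed

lemma vertex_right_module:
  assumes "v \<in> verts Q"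
  shows "vertex_coset R Q I v <#\<^bsub>L\<^esub> carrier L = cls ` path_span (ending_at v)"
proof (intro equalityI subsetI)
  note e = path_elem_closed[OF triv_path[OF assms]]
  fix x assume "x \<in> vertex_coset R Q I v <#\<^bsub>L\<^esub> carrier L"
  then obtain f where f: "f \<in> carrier PA" "x = cls (path_elem R (trivial_path v)) \<otimes>\<^bsub>L\<^esub> cls f"
    by (auto simp: l_coset_def vertex_coset_def carrier_L)
  thus "x \<in> cls ` path_span (ending_at v)"
    using path_span_vertex_left[OF f(1) assms] e by (simp add: cls_hom)
next
  note e = path_elem_closed[OF triv_path[OF assms]]
  fix x assume "x \<in> cls ` path_span (ending_at v)"
  then obtain f where f: "f \<in> path_span (ending_at v)" "x = cls f" by blast
  have "x = cls (path_elem R (trivial_path v)) \<otimes>\<^bsub>L\<^esub> cls f"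
    unfolding f(2) cls_hom(1)[OF e path_spanD(1)[OF f(1)]] path_span_ending_at[OF f(1) assms] ..
  thus "x \<in> vertex_coset R Q I v <#\<^bsub>L\<^esub> carrier L"
    using cls_closed[OF path_spanD(1)[OF f(1)]] by (auto simp: l_coset_def vertex_coset_def)
qed

lemma arrow_left_module:
  assumes "a \<in> arcs Q"
  shows "carrier L #>\<^bsub>L\<^esub> arrow_coset R Q I a = cls ` path_span (first_arrow_in {a})"
proof (intro equalityI subsetI)
  note e = path_elem_closed[OF arrow_path_in[OF assms]]
  fix x assume "x \<in> carrier L #>\<^bsub>L\<^esub> arrow_coset R Q I a"
  then obtain f where f: "f \<in> carrier PA" "x = cls f \<otimes>\<^bsub>L\<^esub> cls (arrow_elem R Q a)"
    by (auto simp: r_coset_def arrow_coset_def carrier_L)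
  thus "x \<in> cls ` path_span (first_arrow_in {a})"
    using path_span_arrow_right[OF f(1) assms] e by (simp add: cls_hom)
next
  note e = path_elem_closed[OF arrow_path_in[OF assms]]
  fix x assume "x \<in> cls ` path_span (first_arrow_in {a})"
  then obtain f g where f: "x = cls f" "g \<in> carrier PA" "f = g \<otimes>\<^bsub>PA\<^esub> arrow_elem R Q a"
    using path_span_first_arrow[OF _ assms] by blast
  thus "x \<in> carrier L #>\<^bsub>L\<^esub> arrow_coset R Q I a"
    using cls_closed[OF f(2)] e by (auto simp: r_coset_def arrow_coset_def cls_hom[symmetric])
qed

lemma arrow_right_module:
  assumes "a \<in> arcs Q"
  shows "arrow_coset R Q I a <#\<^bsub>L\<^esub> carrier L = cls ` path_span (last_arrow_in {a})"
proof (intro equalityI subsetI)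
  note e = path_elem_closed[OF arrow_path_in[OF assms]]
  fix x assume "x \<in> arrow_coset R Q I a <#\<^bsub>L\<^esub> carrier L"
  then obtain f where f: "f \<in> carrier PA" "x = cls (arrow_elem R Q a) \<otimes>\<^bsub>L\<^esub> cls f"
    by (auto simp: l_coset_def arrow_coset_def carrier_L)
  thus "x \<in> cls ` path_span (last_arrow_in {a})"
    using path_span_arrow_left[OF f(1) assms] e by (simp add: cls_hom)
next
  note e = path_elem_closed[OF arrow_path_in[OF assms]]
  fix x assume "x \<in> cls ` path_span (last_arrow_in {a})"
  then obtain f g where f: "x = cls f" "g \<in> carrier PA" "f = arrow_elem R Q a \<otimes>\<^bsub>PA\<^esub> g"
    using path_span_last_arrow[OF _ assms] by blast
  thus "x \<in> arrow_coset R Q I a <#\<^bsub>L\<^esub> carrier L"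
    using cls_closed[OF f(2)] e by (auto simp: l_coset_def arrow_coset_def cls_hom[symmetric])
qed

lemma path_span_empty: "path_span {} = {\<zero>\<^bsub>PA\<^esub>}"
proof -
  have "f = \<zero>\<^bsub>PA\<^esub>" if "f \<in> path_span {}" for f
    using path_spanD(3)[OF that] by (auto simp: fun_eq_iff zero_eq)
  thus ?thesis using path_span_zero by blast
qed

text \<open>Induction on the set of arrows: an element is cut by first arrow into a part beginning
  with the new arrow \<open>a\<close> and a remainder, which turns a sum of modules into a union of
  supports.\<close>

lemma arrows_left_sum:
  assumes "S \<subseteq> arcs Q"
  shows "left_sum L (arrow_coset R Q I) S = cls ` path_span (first_arrow_in S)"
  using finite_subset[OF assms Q.finite_arcs] assms
proof (induction S rule: finite_induct)
  case empty
  show ?case by (simp add: left_sum_def path_span_empty cls_zero)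
next
  case (insert a S)
  have a: "a \<in> arcs Q" using insert by simp
  have ac: "arrow_coset R Q I i \<in> carrier L" if "i \<in> insert a S" for i
    unfolding arrow_coset_def using that insert.prems
    by (intro cls_closed path_elem_closed arrow_path_in) auto
  have "left_sum L (arrow_coset R Q I) (insert a S) =
      {c \<otimes>\<^bsub>L\<^esub> arrow_coset R Q I a \<oplus>\<^bsub>L\<^esub> y | c y. c \<in> carrier L \<and> y \<in> cls ` path_span (first_arrow_in S)}"
    using L.left_sum_insert[OF insert(1,2) ac] insert by simp
  also have "\<dots> = {x \<oplus>\<^bsub>L\<^esub> y | x y. x \<in> carrier L #>\<^bsub>L\<^esub> arrow_coset R Q I a \<and> y \<in> cls ` path_span (first_arrow_in S)}"
    unfolding r_coset_def by blast
  also have "\<dots> = cls ` path_span (first_arrow_in (insert a S))"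
    unfolding arrow_left_module[OF a]
  proof (intro equalityI subsetI)
    fix z assume "z \<in> {x \<oplus>\<^bsub>L\<^esub> y | x y. x \<in> cls ` path_span (first_arrow_in {a}) \<and>
        y \<in> cls ` path_span (first_arrow_in S)}"
    then obtain f g where fg: "f \<in> path_span (first_arrow_in {a})" "g \<in> path_span (first_arrow_in S)"
        "z = cls f \<oplus>\<^bsub>L\<^esub> cls g" by blast
    have "f \<in> path_span (first_arrow_in (insert a S))" "g \<in> path_span (first_arrow_in (insert a S))"
      using fg by (auto intro: path_span_mono)
    hence "f \<oplus>\<^bsub>PA\<^esub> g \<in> path_span (first_arrow_in (insert a S))" by (rule path_span_add)
    moreover have "z = cls (f \<oplus>\<^bsub>PA\<^esub> g)" using fg by (simp add: cls_hom path_spanD(1))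
    ultimately show "z \<in> cls ` path_span (first_arrow_in (insert a S))" by blast
  next
    fix z assume "z \<in> cls ` path_span (first_arrow_in (insert a S))"
    then obtain f where f: "f \<in> path_span (first_arrow_in (insert a S))" "z = cls f" by blast
    have "f \<in> path_span (first_arrow_in {a} \<union> first_arrow_in S)"
      using f(1) by (rule path_span_mono) auto
    then obtain g h where gh: "g \<in> path_span (first_arrow_in {a})"
        "h \<in> path_span (first_arrow_in S - first_arrow_in {a})" "f = g \<oplus>\<^bsub>PA\<^esub> h"
      by (rule path_span_restrict)
    have "h \<in> path_span (first_arrow_in S)" using gh(2) by (rule path_span_mono) auto
    moreover have "z = cls g \<oplus>\<^bsub>L\<^esub> cls h" using gh f by (simp add: cls_hom path_spanD(1))
    ultimately show "z \<in> {x \<oplus>\<^bsub>L\<^esub> y | x y. x \<in> cls ` path_span (first_arrow_in {a}) \<and>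
        y \<in> cls ` path_span (first_arrow_in S)}" using gh(1) by blast
  qed
  finally show ?case .
qed

lemma arrows_right_sum:
  assumes "S \<subseteq> arcs Q"
  shows "right_sum L (arrow_coset R Q I) S = cls ` path_span (last_arrow_in S)"
  using finite_subset[OF assms Q.finite_arcs] assms
proof (induction S rule: finite_induct)
  case empty
  show ?case by (simp add: right_sum_def path_span_empty cls_zero)
next
  case (insert a S)
  have a: "a \<in> arcs Q" using insert by simp
  have ac: "arrow_coset R Q I i \<in> carrier L" if "i \<in> insert a S" for i
    unfolding arrow_coset_def using that insert.prems
    by (intro cls_closed path_elem_closed arrow_path_in) auto
  have "right_sum L (arrow_coset R Q I) (insert a S) =
      {arrow_coset R Q I a \<otimes>\<^bsub>L\<^esub> c \<oplus>\<^bsub>L\<^esub> y | c y. c \<in> carrier L \<and> y \<in> cls ` path_span (last_arrow_in S)}"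
    using L.right_sum_insert[OF insert(1,2) ac] insert by simp
  also have "\<dots> = {x \<oplus>\<^bsub>L\<^esub> y | x y. x \<in> arrow_coset R Q I a <#\<^bsub>L\<^esub> carrier L \<and> y \<in> cls ` path_span (last_arrow_in S)}"
    unfolding l_coset_def by blast
  also have "\<dots> = cls ` path_span (last_arrow_in (insert a S))"
    unfolding arrow_right_module[OF a]
  proof (intro equalityI subsetI)
    fix z assume "z \<in> {x \<oplus>\<^bsub>L\<^esub> y | x y. x \<in> cls ` path_span (last_arrow_in {a}) \<and>
        y \<in> cls ` path_span (last_arrow_in S)}"
    then obtain f g where fg: "f \<in> path_span (last_arrow_in {a})" "g \<in> path_span (last_arrow_in S)"
        "z = cls f \<oplus>\<^bsub>L\<^esub> cls g" by blast
    have "f \<in> path_span (last_arrow_in (insert a S))" "g \<in> path_span (last_arrow_in (insert a S))"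
      using fg by (auto intro: path_span_mono)
    hence "f \<oplus>\<^bsub>PA\<^esub> g \<in> path_span (last_arrow_in (insert a S))" by (rule path_span_add)
    moreover have "z = cls (f \<oplus>\<^bsub>PA\<^esub> g)" using fg by (simp add: cls_hom path_spanD(1))
    ultimately show "z \<in> cls ` path_span (last_arrow_in (insert a S))" by blast
  next
    fix z assume "z \<in> cls ` path_span (last_arrow_in (insert a S))"
    then obtain f where f: "f \<in> path_span (last_arrow_in (insert a S))" "z = cls f" by blast
    have "f \<in> path_span (last_arrow_in {a} \<union> last_arrow_in S)"
      using f(1) by (rule path_span_mono) auto
    then obtain g h where gh: "g \<in> path_span (last_arrow_in {a})"
        "h \<in> path_span (last_arrow_in S - last_arrow_in {a})" "f = g \<oplus>\<^bsub>PA\<^esub> h"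
      by (rule path_span_restrict)
    have "h \<in> path_span (last_arrow_in S)" using gh(2) by (rule path_span_mono) auto
    moreover have "z = cls g \<oplus>\<^bsub>L\<^esub> cls h" using gh f by (simp add: cls_hom path_spanD(1))
    ultimately show "z \<in> {x \<oplus>\<^bsub>L\<^esub> y | x y. x \<in> cls ` path_span (last_arrow_in {a}) \<and>
        y \<in> cls ` path_span (last_arrow_in S)}" using gh(1) by blast
  qed
  finally show ?case .
qed

end

section \<open>Monomial ideals\<close>

locale field_quiver_quotient = quiver_quotient R Q I + K: field R
  for R :: "('r, 's) ring_scheme" (structure) and Q :: "('v, 'e) pre_digraph" and I
begin

text \<open>By definition \<open>left_ideal\<close> speaks only of ring multiplication; scalar
  multiplication by \<open>c\<close> is multiplication by the class of \<open>c\<close> times the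
  identity.\<close>

lemma left_ideal_smult:
  assumes "left_ideal L N" "x \<in> N" "c \<in> carrier R"
  shows "c \<odot>\<^bsub>L\<^esub> x \<in> N"
proof -
  have "x \<in> carrier L" using L.left_idealD(1)[OF assms(1)] assms(2) by blast
  then obtain f where f: "f \<in> carrier PA" "x = cls f" by (auto simp: carrier_L)
  have "c \<odot>\<^bsub>L\<^esub> x = cls ((c \<odot>\<^bsub>PA\<^esub> \<one>\<^bsub>PA\<^esub>) \<otimes>\<^bsub>PA\<^esub> f)"
    using f assms(3) by (simp add: smult_cls smult_mult one_closed)
  also have "\<dots> = cls (c \<odot>\<^bsub>PA\<^esub> \<one>\<^bsub>PA\<^esub>) \<otimes>\<^bsub>L\<^esub> x"
    using f assms(3) by (simp add: cls_hom smult_closed one_closed)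
  finally show ?thesis
    using L.left_idealD(4)[OF assms(1) _ assms(2)] assms(3) by (simp add: cls_closed smult_closed one_closed)
qed

lemma right_ideal_smult:
  assumes "right_ideal L N" "x \<in> N" "c \<in> carrier R"
  shows "c \<odot>\<^bsub>L\<^esub> x \<in> N"
proof -
  have "x \<in> carrier L" using L.right_idealD(1)[OF assms(1)] assms(2) by blast
  then obtain f where f: "f \<in> carrier PA" "x = cls f" by (auto simp: carrier_L)
  have "c \<odot>\<^bsub>L\<^esub> x = cls (f \<otimes>\<^bsub>PA\<^esub> (c \<odot>\<^bsub>PA\<^esub> \<one>\<^bsub>PA\<^esub>))"
    using f assms(3) by (simp add: smult_cls mult_smult one_closed)
  also have "\<dots> = x \<otimes>\<^bsub>L\<^esub> cls (c \<odot>\<^bsub>PA\<^esub> \<one>\<^bsub>PA\<^esub>)"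
    using f assms(3) by (simp add: cls_hom smult_closed one_closed)
  finally show ?thesis
    using L.right_idealD(4)[OF assms(1) _ assms(2)] assms(3) by (simp add: cls_closed smult_closed one_closed)
qed

lemma field_inv_closed: "c \<in> carrier R \<Longrightarrow> c \<noteq> \<zero> \<Longrightarrow> inv c \<in> carrier R"
  by (rule R.Units_inv_closed) (simp add: K.field_Units)

lemma smult_cancel:
  assumes "c \<in> carrier R" "c \<noteq> \<zero>" "x \<in> carrier L"
  shows "inv c \<odot>\<^bsub>L\<^esub> (c \<odot>\<^bsub>L\<^esub> x) = x"
proof -
  have "c \<in> Units R" using assms K.field_Units by blast
  thus ?thesis using assms by (simp add: M.smult_assoc1[symmetric])
qed

text \<open>Subtraction is written as adding a multiple by \<open>\<ominus> \<one>\<close>, so that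
  \<open>left_ideal_smult\<close> and \<open>right_ideal_smult\<close> apply to it directly.\<close>

lemma cls_add_cancel:
  assumes "f \<in> carrier PA" "g \<in> carrier PA"
  shows "cls (f \<oplus>\<^bsub>PA\<^esub> g) \<oplus>\<^bsub>L\<^esub> (\<ominus> \<one>) \<odot>\<^bsub>L\<^esub> cls g = cls f"
  unfolding cls_hom(2)[OF assms, symmetric] using cls_closed[OF assms(1)] cls_closed[OF assms(2)]
  by (simp add: M.smult_l_minus L.a_assoc L.r_neg)

text \<open>The span of the paths of length at least 2 that lie in \<open>I\<close> is itself a
  two-sided ideal, as composing with a path keeps membership in \<open>I\<close> and does not
  shorten. It contains the generators, so it contains \<open>I\<close>.\<close>

lemma generated_by_long_paths_monomial:
  assumes "generated_by_long_paths R Q I" "f \<in> I" "f p \<noteq> \<zero>"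
  shows "path_elem R p \<in> I" "2 \<le> path_length p"
proof -
  obtain P where P: "P \<subseteq> {p \<in> qpaths Q. 2 \<le> path_length p}" "I = genideal PA (path_elem R ` P)"
    using assms(1) by (auto simp: generated_by_long_paths_def)
  let ?X = "{p. path_elem R p \<in> I \<and> 2 \<le> path_length p}"
  have PQ: "path_elem R ` P \<subseteq> carrier PA" using P(1) by (auto simp: path_elem_closed)
  have mult: "f \<otimes>\<^bsub>PA\<^esub> g \<in> path_span ?X" "g \<otimes>\<^bsub>PA\<^esub> f \<in> path_span ?X"
    if "f \<in> carrier PA" "g \<in> path_span ?X" for f g
  proof -
    have f: "f \<in> path_span UNIV" using that by (intro path_spanI) auto
    show "f \<otimes>\<^bsub>PA\<^esub> g \<in> path_span ?X" "g \<otimes>\<^bsub>PA\<^esub> f \<in> path_span ?X"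
      by (rule path_span_mult[OF f that(2)] path_span_mult[OF that(2) f];
          auto intro!: path_elem_ideal_mult simp: path_length_def path_comp_def[of _ "(_, _)"])+
  qed
  have "ideal (path_span ?X) PA"
  proof (rule idealI[OF ring_path_algebra])
    have "left_ideal PA (path_span ?X)"
      by (rule A.left_idealI)
        (use path_spanD(1) mult in \<open>auto intro: path_span_zero path_span_add\<close>)
    thus "subgroup (path_span ?X) (add_monoid PA)"
      by (auto simp: left_ideal_def additive_subgroup.a_subgroup)
  qed (use mult in auto)
  moreover have "path_elem R ` P \<subseteq> path_span ?X"
  proof
    fix x assume "x \<in> path_elem R ` P"
    then obtain q where q: "q \<in> P" "x = path_elem R q" by blast
    have "path_elem R q \<in> I"
      unfolding P(2) using A.genideal_self[OF PQ] q(1) by blast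
    thus "x \<in> path_span ?X" using q P(1) by (auto intro!: path_span_elem)
  qed
  ultimately have "I \<subseteq> path_span ?X"
    unfolding P(2) by (rule A.genideal_minimal)
  hence "p \<in> ?X" using assms path_spanD(2) by blast
  thus "path_elem R p \<in> I" "2 \<le> path_length p" by auto
qed

section \<open>Locality of the modules at a vertex\<close>

lemma out_arcs_span:
  "path_span (first_arrow_in (out_arcs Q v)) = path_span (starting_at v \<inter> {p. snd p \<noteq> []})"
proof -
  have "p \<in> first_arrow_in (out_arcs Q v) \<longleftrightarrow> p \<in> starting_at v \<inter> {p. snd p \<noteq> []}" if "p \<in> qpaths Q" for p
    using path_hd(1,2)[OF that] by auto
  thus ?thesis by (intro path_span_cong) blast
qed

lemma in_arcs_span:
  "path_span (last_arrow_in (in_arcs Q v)) = path_span (ending_at v \<inter> {p. snd p \<noteq> []})"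
proof -
  have "p \<in> last_arrow_in (in_arcs Q v) \<longleftrightarrow> p \<in> ending_at v \<inter> {p. snd p \<noteq> []}" if "p \<in> qpaths Q" for p
    using path_last(1,2)[OF that] by auto
  thus ?thesis by (intro path_span_cong) blast
qed

lemma path_span_vertex_split:
  assumes "f \<in> path_span X" "v \<in> verts Q" "\<And>p. p \<in> X \<Longrightarrow> p \<in> qpaths Q \<Longrightarrow> snd p = [] \<Longrightarrow> p = trivial_path v"
  obtains j where "f = f (trivial_path v) \<odot>\<^bsub>PA\<^esub> path_elem R (trivial_path v) \<oplus>\<^bsub>PA\<^esub> j"
    "j \<in> path_span (X \<inter> {p. snd p \<noteq> []})"
proof
  show "f(trivial_path v := \<zero>) \<in> path_span (X \<inter> {p. snd p \<noteq> []})"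
    by (rule path_span_mono[OF path_span_upd[OF assms(1)]]) (use assms(3) in auto)
qed (rule path_split[OF path_spanD(1)[OF assms(1)] triv_path[OF assms(2)]])

lemma starting_at_trivial: "p \<in> starting_at v \<Longrightarrow> snd p = [] \<Longrightarrow> p = trivial_path v"
  by (cases p) (auto simp: trivial_path_def)

lemma ending_at_trivial: "p \<in> ending_at v \<Longrightarrow> snd p = [] \<Longrightarrow> p = trivial_path v"
  by (cases p) (auto simp: trivial_path_def)

text \<open>The coefficient at the trivial path decides: if \<open>e\<^sub>v\<close> is an element
  of \<open>I\<close> plus an element supported off the trivial path, then that element of
  \<open>I\<close> has a nonzero coefficient at a path of length 0, against
  \<open>long\<close>.\<close>

lemma vertex_coset_notin:
  assumes long: "\<And>f p. f \<in> I \<Longrightarrow> f p \<noteq> \<zero> \<Longrightarrow> 2 \<le> path_length p"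
    and v: "v \<in> verts Q" and X: "trivial_path v \<notin> X"
  shows "cls (path_elem R (trivial_path v)) \<notin> cls ` path_span X"
proof
  note e = path_elem_closed[OF triv_path[OF v]]
  assume "cls (path_elem R (trivial_path v)) \<in> cls ` path_span X"
  then obtain f where f: "f \<in> path_span X" "cls (path_elem R (trivial_path v)) = cls f" by blast
  from e f(2) obtain i where i: "i \<in> I" "path_elem R (trivial_path v) = i \<oplus>\<^bsub>PA\<^esub> f" by (rule cls_eqD)
  have "\<one> = i (trivial_path v) \<oplus> f (trivial_path v)"
    using fun_cong[OF i(2), of "trivial_path v"] by (simp add: add_eq path_elem_def)
  hence "i (trivial_path v) \<noteq> \<zero>"
    using path_spanD(3)[OF f(1) X] by auto
  from long[OF i(1) this] show False by (simp add: path_length_def trivial_path_def)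
qed

text \<open>By \<open>local_moduleI\<close>, applied to the image \<open>J\<close> of the span of
  the nontrivial paths: a submodule not inside \<open>J\<close> contains the class of some
  \<open>c e\<^sub>v + j\<close> with \<open>c\<close> nonzero, and descending induction on the
  length puts all paths starting at \<open>v\<close> into it. The induction variable
  \<open>m\<close> bounds how far a path falls short of length \<open>n\<close>, so at
  \<open>m = 0\<close> the path vanishes in the quotient.\<close>

lemma vertex_left_local:
  assumes long: "\<And>f p. f \<in> I \<Longrightarrow> f p \<noteq> \<zero> \<Longrightarrow> 2 \<le> path_length p"
    and bound: "\<And>p. p \<in> qpaths Q \<Longrightarrow> n \<le> path_length p \<Longrightarrow> path_elem R p \<in> I"
    and v: "v \<in> verts Q"
  shows "local_module (left_ideal L) (cls ` path_span (starting_at v))"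
    and "module_rad (left_ideal L) (cls ` path_span (starting_at v)) =
      cls ` path_span (first_arrow_in (out_arcs Q v))"
proof -
  let ?M = "cls ` path_span (starting_at v)"
  let ?J = "cls ` path_span (first_arrow_in (out_arcs Q v))"
  let ?e = "path_elem R (trivial_path v)"
  have J: "left_ideal L ?J"
  proof (rule cls_path_span_left_ideal)
    fix f g assume f: "f \<in> carrier PA" and g: "g \<in> path_span (first_arrow_in (out_arcs Q v))"
    have "f \<in> path_span UNIV" using f by (intro path_spanI) auto
    thus "f \<otimes>\<^bsub>PA\<^esub> g \<in> path_span (first_arrow_in (out_arcs Q v))"
      using g by (rule path_span_mult) (auto simp: path_comp_def)
  qed
  have JM: "?J \<subset> ?M"
  proof -
    have "?J \<subseteq> ?M" unfolding out_arcs_span by (intro image_mono subsetI) (erule path_span_mono, auto)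
    moreover have "cls ?e \<in> ?M"
      using v by (intro imageI path_span_elem triv_path) (auto simp: trivial_path_def)
    moreover have "cls ?e \<notin> ?J"
      using vertex_coset_notin[OF long v] by (auto simp: trivial_path_def)
    ultimately show ?thesis by blast
  qed
  have N_eq: "N = ?M" if N: "left_ideal L N" "N \<subseteq> ?M" "\<not> N \<subseteq> ?J" for N
  proof -
    from N(2,3) obtain f where f: "f \<in> path_span (starting_at v)" "cls f \<in> N" "cls f \<notin> ?J" by blast
    define c where "c = f (trivial_path v)"
    obtain j where j: "f = c \<odot>\<^bsub>PA\<^esub> ?e \<oplus>\<^bsub>PA\<^esub> j" "j \<in> path_span (starting_at v \<inter> {p. snd p \<noteq> []})"
      unfolding c_def using f(1) v starting_at_trivial by (rule path_span_vertex_split)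
    have c: "c \<in> carrier R" unfolding c_def by (rule carrierD(1)[OF path_spanD(1)[OF f(1)]])
    note e = path_elem_closed[OF triv_path[OF v]] and jc = path_spanD(1)[OF j(2)]
    \<comment> \<open>With \<open>c = \<zero>\<close>, \<open>f\<close> would be \<open>j\<close>,
      whose class lies in the candidate radical, contrary to the choice of \<open>f\<close>.\<close>
    have "c \<noteq> \<zero>"
    proof
      assume "c = \<zero>"
      hence "f = j" using j(1) e jc carrierD(1)[OF e] carrierD(1)[OF jc]
        by (auto simp: fun_eq_iff add_eq smult_eq)
      thus False using f(3) j(2) unfolding out_arcs_span by blast
    qed
    txt \<open>Multiplying \<open>f\<close> by a path \<open>p\<close> starting at \<open>v\<close> gives \<open>c p\<close> plus longer paths starting at
      \<open>v\<close>, and the latter are already known to lie in \<open>N\<close>.\<close>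
    have "cls (path_elem R p) \<in> N"
      if "p \<in> qpaths Q" "fst p = v" "n \<le> path_length p + m" for p m
      using that
    proof (induction m arbitrary: p)
      case 0
      hence "path_elem R p \<in> I" using bound by simp
      hence "cls (path_elem R p) = \<zero>\<^bsub>L\<^esub>" using 0 by (simp add: cls_eq_zero_iff path_elem_closed)
      thus ?case using L.left_idealD(2)[OF N(1)] by simp
    next
      case (Suc m)
      let ?p = "path_elem R p"
      note p = path_elem_closed[OF Suc.prems(1)]
      have "?p \<otimes>\<^bsub>PA\<^esub> j \<in> path_span {q. fst q = v \<and> n \<le> path_length q + m}"
      proof (rule path_span_mult[OF path_span_elem[OF Suc.prems(1) singletonI] j(2)])
        fix r q assume q: "q \<in> starting_at v \<inter> {p. snd p \<noteq> []}" "r \<in> {p}"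
        have "Suc 0 \<le> length (snd q)" using q(1) by (simp add: Suc_le_eq)
        moreover have "n \<le> length (snd p) + Suc m" using Suc.prems(3) by (simp add: path_length_def)
        ultimately have "n \<le> length (snd q) + length (snd p) + m" by linarith
        thus "path_comp r q \<in> {q. fst q = v \<and> n \<le> path_length q + m}"
          using q by (simp add: path_comp_def path_length_def)
      qed
      hence "cls (?p \<otimes>\<^bsub>PA\<^esub> j) \<in> N"
      proof (induction rule: path_span_induct)
        case zero
        show ?case using L.left_idealD(2)[OF N(1)] cls_zero by (simp only:)
      next
        case (step g d q)
        have "cls (path_elem R q) \<in> N" using Suc.IH step by auto
        hence "d \<odot>\<^bsub>L\<^esub> cls (path_elem R q) \<in> N" using step by (intro left_ideal_smult[OF N(1)])
        hence "cls (d \<odot>\<^bsub>PA\<^esub> path_elem R q) \<in> N" using step by (simp add: smult_cls path_elem_closed)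
        from L.left_idealD(3)[OF N(1) this step.IH] show ?case
          using step path_spanD(1)[OF step(1)] by (simp add: cls_hom smult_closed path_elem_closed)
      qed
      hence "(\<ominus> \<one>) \<odot>\<^bsub>L\<^esub> cls (?p \<otimes>\<^bsub>PA\<^esub> j) \<in> N" by (intro left_ideal_smult[OF N(1)]) auto
      moreover have "cls (?p \<otimes>\<^bsub>PA\<^esub> f) \<in> N"
        using L.left_idealD(4)[OF N(1) cls_closed[OF p] f(2)] p path_spanD(1)[OF f(1)]
        by (simp add: cls_hom)
      ultimately have "cls (?p \<otimes>\<^bsub>PA\<^esub> f) \<oplus>\<^bsub>L\<^esub> (\<ominus> \<one>) \<odot>\<^bsub>L\<^esub> cls (?p \<otimes>\<^bsub>PA\<^esub> j) \<in> N"
        by (intro L.left_idealD(3)[OF N(1)])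
      also have "?p \<otimes>\<^bsub>PA\<^esub> f = c \<odot>\<^bsub>PA\<^esub> ?p \<oplus>\<^bsub>PA\<^esub> ?p \<otimes>\<^bsub>PA\<^esub> j"
        using p e jc c path_elem_vertex_right[OF Suc.prems(1,2)]
        by (subst j(1)) (simp add: A.r_distr smult_closed mult_smult)
      also have "cls (c \<odot>\<^bsub>PA\<^esub> ?p \<oplus>\<^bsub>PA\<^esub> ?p \<otimes>\<^bsub>PA\<^esub> j) \<oplus>\<^bsub>L\<^esub> (\<ominus> \<one>) \<odot>\<^bsub>L\<^esub> cls (?p \<otimes>\<^bsub>PA\<^esub> j) =
          c \<odot>\<^bsub>L\<^esub> cls ?p"
        using cls_add_cancel[OF smult_closed[OF c p] mult_closed[OF p jc]] smult_cls[OF c p] by (simp only:)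
      finally have "inv c \<odot>\<^bsub>L\<^esub> (c \<odot>\<^bsub>L\<^esub> cls ?p) \<in> N"
        using field_inv_closed[OF c \<open>c \<noteq> \<zero>\<close>] by (rule left_ideal_smult[OF N(1)])
      thus ?case using smult_cancel[OF c \<open>c \<noteq> \<zero>\<close> cls_closed[OF p]] by simp
    qed
    \<comment> \<open>The trivial path has length 0, so the choice \<open>m = n\<close> covers it;
      its class then generates the whole module.\<close>
    from this[of "trivial_path v" n] have "cls ?e \<in> N"
      using triv_path[OF v] by (simp add: trivial_path_def)
    hence "cls g \<in> N" if "g \<in> path_span (starting_at v)" for g
    proof -
      have g: "g \<in> carrier PA" using that by (rule path_spanD(1))
      have "cls g = cls g \<otimes>\<^bsub>L\<^esub> cls ?e"
        unfolding cls_hom(1)[OF g e] path_span_starting_at[OF that v] ..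
      thus ?thesis using L.left_idealD(4)[OF N(1) cls_closed[OF g] \<open>cls ?e \<in> N\<close>] by simp
    qed
    thus "N = ?M" using N(2) by blast
  qed
  show "local_module (left_ideal L) ?M"
    by (rule local_moduleI(1)[of "left_ideal L", OF J JM N_eq])
  show "module_rad (left_ideal L) ?M = ?J"
    by (rule local_moduleI(2)[of "left_ideal L", OF J JM N_eq])
qed

text \<open>The mirror image of \<open>vertex_left_local\<close>: \<open>c e\<^sub>v + j\<close> is
  multiplied from the right by a path \<open>p\<close> ending at \<open>v\<close>, which gives
  \<open>c p\<close> plus longer paths ending at \<open>v\<close>.\<close>

lemma vertex_right_local:
  assumes long: "\<And>f p. f \<in> I \<Longrightarrow> f p \<noteq> \<zero> \<Longrightarrow> 2 \<le> path_length p"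
    and bound: "\<And>p. p \<in> qpaths Q \<Longrightarrow> n \<le> path_length p \<Longrightarrow> path_elem R p \<in> I"
    and v: "v \<in> verts Q"
  shows "local_module (right_ideal L) (cls ` path_span (ending_at v))"
    and "module_rad (right_ideal L) (cls ` path_span (ending_at v)) =
      cls ` path_span (last_arrow_in (in_arcs Q v))"
proof -
  let ?M = "cls ` path_span (ending_at v)"
  let ?J = "cls ` path_span (last_arrow_in (in_arcs Q v))"
  let ?e = "path_elem R (trivial_path v)"
  have J: "right_ideal L ?J"
  proof (rule cls_path_span_right_ideal)
    fix f g assume f: "f \<in> carrier PA" and g: "g \<in> path_span (last_arrow_in (in_arcs Q v))"
    have "f \<in> path_span UNIV" using f by (intro path_spanI) auto
    with g show "g \<otimes>\<^bsub>PA\<^esub> f \<in> path_span (last_arrow_in (in_arcs Q v))"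
      by (rule path_span_mult) (auto simp: path_comp_def)
  qed
  have JM: "?J \<subset> ?M"
  proof -
    have "?J \<subseteq> ?M" unfolding in_arcs_span by (intro image_mono subsetI) (erule path_span_mono, auto)
    moreover have "cls ?e \<in> ?M"
      using v by (intro imageI path_span_elem triv_path) (auto simp: trivial_path_def)
    moreover have "cls ?e \<notin> ?J"
      using vertex_coset_notin[OF long v] by (auto simp: trivial_path_def)
    ultimately show ?thesis by blast
  qed
  have N_eq: "N = ?M" if N: "right_ideal L N" "N \<subseteq> ?M" "\<not> N \<subseteq> ?J" for N
  proof -
    from N(2,3) obtain f where f: "f \<in> path_span (ending_at v)" "cls f \<in> N" "cls f \<notin> ?J" by blast
    define c where "c = f (trivial_path v)"
    obtain j where j: "f = c \<odot>\<^bsub>PA\<^esub> ?e \<oplus>\<^bsub>PA\<^esub> j" "j \<in> path_span (ending_at v \<inter> {p. snd p \<noteq> []})"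
      unfolding c_def using f(1) v ending_at_trivial by (rule path_span_vertex_split)
    have c: "c \<in> carrier R" unfolding c_def by (rule carrierD(1)[OF path_spanD(1)[OF f(1)]])
    note e = path_elem_closed[OF triv_path[OF v]] and jc = path_spanD(1)[OF j(2)]
    have "c \<noteq> \<zero>"
    proof
      assume "c = \<zero>"
      hence "f = j" using j(1) e jc carrierD(1)[OF e] carrierD(1)[OF jc]
        by (auto simp: fun_eq_iff add_eq smult_eq)
      thus False using f(3) j(2) unfolding in_arcs_span by blast
    qed
    have "cls (path_elem R p) \<in> N"
      if "p \<in> qpaths Q" "path_target Q p = v" "n \<le> path_length p + m" for p m
      using that
    proof (induction m arbitrary: p)
      case 0
      hence "path_elem R p \<in> I" using bound by simp
      hence "cls (path_elem R p) = \<zero>\<^bsub>L\<^esub>" using 0 by (simp add: cls_eq_zero_iff path_elem_closed)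
      thus ?case using L.right_idealD(2)[OF N(1)] by simp
    next
      case (Suc m)
      let ?p = "path_elem R p"
      note p = path_elem_closed[OF Suc.prems(1)]
      have "j \<otimes>\<^bsub>PA\<^esub> ?p \<in> path_span {q. path_target Q q = v \<and> n \<le> path_length q + m}"
      proof (rule path_span_mult[OF j(2) path_span_elem[OF Suc.prems(1) singletonI]])
        fix q r assume q: "q \<in> ending_at v \<inter> {p. snd p \<noteq> []}" "r \<in> {p}"
          "path_source q = path_target Q r"
        have "Suc 0 \<le> length (snd q)" using q(1) by (simp add: Suc_le_eq)
        moreover have "n \<le> length (snd p) + Suc m" using Suc.prems(3) by (simp add: path_length_def)
        ultimately have "n \<le> length (snd p) + length (snd q) + m" by linarith
        moreover have "path_target Q (path_comp q r) = v" using q by (simp add: target_comp)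
        ultimately show "path_comp q r \<in> {q. path_target Q q = v \<and> n \<le> path_length q + m}"
          using q by (simp add: path_comp_def path_length_def)
      qed
      hence "cls (j \<otimes>\<^bsub>PA\<^esub> ?p) \<in> N"
      proof (induction rule: path_span_induct)
        case zero
        show ?case using L.right_idealD(2)[OF N(1)] cls_zero by (simp only:)
      next
        case (step g d q)
        have "cls (path_elem R q) \<in> N" using Suc.IH step by auto
        hence "d \<odot>\<^bsub>L\<^esub> cls (path_elem R q) \<in> N" using step by (intro right_ideal_smult[OF N(1)])
        hence "cls (d \<odot>\<^bsub>PA\<^esub> path_elem R q) \<in> N" using step by (simp add: smult_cls path_elem_closed)
        from L.right_idealD(3)[OF N(1) this step.IH] show ?case
          using step path_spanD(1)[OF step(1)] by (simp add: cls_hom smult_closed path_elem_closed)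
      qed
      hence "(\<ominus> \<one>) \<odot>\<^bsub>L\<^esub> cls (j \<otimes>\<^bsub>PA\<^esub> ?p) \<in> N" by (intro right_ideal_smult[OF N(1)]) auto
      moreover have "cls (f \<otimes>\<^bsub>PA\<^esub> ?p) \<in> N"
        using L.right_idealD(4)[OF N(1) cls_closed[OF p] f(2)] p path_spanD(1)[OF f(1)]
        by (simp add: cls_hom)
      ultimately have "cls (f \<otimes>\<^bsub>PA\<^esub> ?p) \<oplus>\<^bsub>L\<^esub> (\<ominus> \<one>) \<odot>\<^bsub>L\<^esub> cls (j \<otimes>\<^bsub>PA\<^esub> ?p) \<in> N"
        by (intro L.right_idealD(3)[OF N(1)])
      also have "f \<otimes>\<^bsub>PA\<^esub> ?p = c \<odot>\<^bsub>PA\<^esub> ?p \<oplus>\<^bsub>PA\<^esub> j \<otimes>\<^bsub>PA\<^esub> ?p"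
        using p e jc c path_elem_vertex_left[OF Suc.prems(1,2)]
        by (subst j(1)) (simp add: A.l_distr smult_closed smult_mult)
      also have "cls (c \<odot>\<^bsub>PA\<^esub> ?p \<oplus>\<^bsub>PA\<^esub> j \<otimes>\<^bsub>PA\<^esub> ?p) \<oplus>\<^bsub>L\<^esub> (\<ominus> \<one>) \<odot>\<^bsub>L\<^esub> cls (j \<otimes>\<^bsub>PA\<^esub> ?p) =
          c \<odot>\<^bsub>L\<^esub> cls ?p"
        using cls_add_cancel[OF smult_closed[OF c p] mult_closed[OF jc p]] smult_cls[OF c p] by (simp only:)
      finally have "inv c \<odot>\<^bsub>L\<^esub> (c \<odot>\<^bsub>L\<^esub> cls ?p) \<in> N"
        using field_inv_closed[OF c \<open>c \<noteq> \<zero>\<close>] by (rule right_ideal_smult[OF N(1)])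
      thus ?case using smult_cancel[OF c \<open>c \<noteq> \<zero>\<close> cls_closed[OF p]] by simp
    qed
    from this[of "trivial_path v" n] have "cls ?e \<in> N"
      using triv_path[OF v] by (simp add: trivial_path_def)
    hence "cls g \<in> N" if "g \<in> path_span (ending_at v)" for g
    proof -
      have g: "g \<in> carrier PA" using that by (rule path_spanD(1))
      have "cls g = cls ?e \<otimes>\<^bsub>L\<^esub> cls g"
        unfolding cls_hom(1)[OF e g] path_span_ending_at[OF that v] ..
      thus ?thesis using L.right_idealD(4)[OF N(1) cls_closed[OF g] \<open>cls ?e \<in> N\<close>] by simp
    qed
    thus "N = ?M" using N(2) by blast
  qed
  show "local_module (right_ideal L) ?M"
    by (rule local_moduleI(1)[of "right_ideal L", OF J JM N_eq])
  show "module_rad (right_ideal L) ?M = ?J"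
    by (rule local_moduleI(2)[of "right_ideal L", OF J JM N_eq])
qed

text \<open>If \<open>f = i + g\<close> with \<open>i\<close> in \<open>I\<close> and the supports
  of \<open>f\<close> and \<open>g\<close> are disjoint, then \<open>i\<close> agrees with
  \<open>f\<close> on the support of \<open>f\<close>. Monomiality puts each path of that support
  into \<open>I\<close>, hence also \<open>f\<close>.\<close>

lemma cls_path_span_disjoint:
  assumes mono: "\<And>f p. f \<in> I \<Longrightarrow> f p \<noteq> \<zero> \<Longrightarrow> path_elem R p \<in> I" and "X \<inter> Y = {}"
  shows "cls ` path_span X \<inter> cls ` path_span Y = {\<zero>\<^bsub>L\<^esub>}"
proof -
  have "cls f = \<zero>\<^bsub>L\<^esub>" if f: "f \<in> path_span X" and g: "g \<in> path_span Y" "cls f = cls g" for f g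
  proof -
    note fc = path_spanD(1)[OF f] and gc = path_spanD(1)[OF g(1)]
    obtain i where i: "i \<in> I" "f = i \<oplus>\<^bsub>PA\<^esub> g" using cls_eqD[OF fc g(2)] .
    have "f \<in> I"
    proof (rule in_idealI[OF fc])
      fix p assume p: "f p \<noteq> \<zero>"
      hence "p \<notin> Y" using path_spanD(2)[OF f] assms(2) by blast
      hence "i p = f p"
        unfolding i(2) using path_spanD(3)[OF g(1)] carrierD(1)[OF A.Icarr[OF i(1)]] by (simp add: add_eq)
      thus "path_elem R p \<in> I" using mono[OF i(1)] p by simp
    qed
    thus ?thesis using fc by (simp only: cls_eq_zero_iff)
  qed
  moreover have "\<zero>\<^bsub>L\<^esub> \<in> cls ` path_span Z" for Z
    using path_span_zero cls_zero by (metis imageI)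
  ultimately show ?thesis by blast
qed

text \<open>The classes of the finitely many paths shorter than \<open>n\<close> span the quotient,
  because all other paths vanish in it.\<close>

lemma bounded_finitely_generated:
  assumes bound: "\<And>p. p \<in> qpaths Q \<Longrightarrow> n \<le> path_length p \<Longrightarrow> path_elem R p \<in> I"
  shows "finitely_generated_module R L"
proof -
  define S where "S = (\<lambda>p. cls (path_elem R p)) ` {p \<in> qpaths Q. path_length p < n}"
  have "{p \<in> qpaths Q. path_length p < n} \<subseteq> verts Q \<times> {as. set as \<subseteq> arcs Q \<and> length as \<le> n}"
    by (auto simp: path_iff path_length_def Q.awalk_def)
  hence "finite {p \<in> qpaths Q. path_length p < n}"
    by (rule finite_subset) (simp add: finite_lists_length_le)
  hence S: "finite S" "S \<subseteq> carrier L" by (auto simp: S_def intro!: cls_closed path_elem_closed)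
  note W = M.lin_combs_closed[OF S]
  have "cls f \<in> M.lin_combs S" if "f \<in> path_span UNIV" for f
    using that
  proof (induction rule: path_span_induct)
    case zero
    show ?case using W(2) cls_zero by (simp only:)
  next
    case (step g c p)
    have "cls (path_elem R p) \<in> M.lin_combs S"
    proof (cases "path_length p < n")
      case True
      thus ?thesis using W(3) step by (auto simp: S_def)
    next
      case False
      hence "cls (path_elem R p) = \<zero>\<^bsub>L\<^esub>"
        using bound step by (simp add: cls_eq_zero_iff path_elem_closed)
      thus ?thesis using W(2) by simp
    qed
    hence "c \<odot>\<^bsub>L\<^esub> cls (path_elem R p) \<in> M.lin_combs S" using W(5) step by blast
    hence "cls (c \<odot>\<^bsub>PA\<^esub> path_elem R p) \<in> M.lin_combs S" using step by (simp add: smult_cls path_elem_closed)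
    from W(4)[OF this step.IH] show ?case
      using step path_spanD(1)[OF step(1)] by (simp add: cls_hom smult_closed path_elem_closed)
  qed
  moreover have "f \<in> path_span UNIV" if "f \<in> carrier PA" for f
    using that by (intro path_spanI) auto
  ultimately have "carrier L \<subseteq> M.lin_combs S" by (auto simp: carrier_L)
  thus ?thesis unfolding M.finitely_generated_module_iff using S W(1) by blast
qed

lemma butler_ringel_imp_string_algebra:
  assumes "butler_ringel_string_algebra R Q I"
  shows "string_algebra R Q I"
proof -
  have br: "generated_by_long_paths R Q I" "at_most_two_heads_and_tails Q" "special R Q I"
      "arrowwise_bounded R Q I"
    using assms by (auto simp: butler_ringel_string_algebra_def)
  note mono = generated_by_long_paths_monomial[OF br(1)]
  obtain N where N: "\<And>b p. b \<in> arcs Q \<Longrightarrow> p \<in> qpaths Q \<Longrightarrow> N b \<le> path_length p \<Longrightarrow> snd p \<noteq> [] \<Longrightarrow>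
      hd (snd p) = b \<Longrightarrow> path_elem R p \<in> I"
    using br(4) unfolding arrowwise_bounded_def by metis
  \<comment> \<open>The sum over all arrows dominates each individual bound, so one \<open>n\<close>
    works for every first arrow; \<open>Suc\<close> makes \<open>n\<close> positive, so that a path
    of length at least \<open>n\<close> has a first arrow.\<close>
  define n where "n = Suc (\<Sum>b\<in>arcs Q. N b)"
  have bound: "path_elem R p \<in> I" if p: "p \<in> qpaths Q" "n \<le> path_length p" for p
  proof -
    have ne: "snd p \<noteq> []" using p(2) by (auto simp: n_def path_length_def)
    note a = path_hd(1)[OF p(1) ne]
    have "N (hd (snd p)) \<le> (\<Sum>b\<in>arcs Q. N b)" using a by (intro member_le_sum) auto
    thus ?thesis using N[OF a p(1) _ ne] p(2) by (simp add: n_def)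
  qed
  have arcs: "out_arcs Q v \<subseteq> arcs Q" "in_arcs Q v \<subseteq> arcs Q" for v by auto
  have "arrow_radical R Q I"
    unfolding arrow_radical_def Let_def
    by (simp add: vertex_left_module vertex_right_module arrows_left_sum[OF arcs(1)]
        arrows_right_sum[OF arcs(2)] vertex_left_local[OF mono(2) bound]
        vertex_right_local[OF mono(2) bound])
  moreover have "arrow_direct R Q I"
    unfolding arrow_direct_def Let_def
  proof (intro ballI conjI)
    fix a assume a: "a \<in> arcs Q"
    have S: "out_arcs Q (tail Q a) - {a} \<subseteq> arcs Q" "in_arcs Q (head Q a) - {a} \<subseteq> arcs Q" by auto
    show "(carrier L #>\<^bsub>L\<^esub> arrow_coset R Q I a) \<inter>
        left_sum L (arrow_coset R Q I) (out_arcs Q (tail Q a) - {a}) = {\<zero>\<^bsub>L\<^esub>}"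
      unfolding arrow_left_module[OF a] arrows_left_sum[OF S(1)]
      by (rule cls_path_span_disjoint[OF mono(1)]) auto
    show "(arrow_coset R Q I a <#\<^bsub>L\<^esub> carrier L) \<inter>
        right_sum L (arrow_coset R Q I) (in_arcs Q (head Q a) - {a}) = {\<zero>\<^bsub>L\<^esub>}"
      unfolding arrow_right_module[OF a] arrows_right_sum[OF S(2)]
      by (rule cls_path_span_disjoint[OF mono(1)]) auto
  qed
  moreover have "permissible R Q I"
    unfolding permissible_def
  proof (intro ballI notI)
    fix a assume "arrow_elem R Q a \<in> I"
    from mono(2)[OF this, of "arrow_path Q a"] show False
      by (simp add: path_elem_def path_length_def arrow_path_def)
  qed
  ultimately show ?thesis
    unfolding string_algebra_def
    using br bounded_finitely_generated[OF bound] K.commutative_noetherian_local_ring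
      Q.fin_digraph_axioms A.is_ideal by simp
qed

end

section \<open>String algebras over a field\<close>

context field_quiver_quotient
begin

text \<open>An elimination argument in place of dimension counting: the generators in
  \<open>T\<close> are removed one at a time, keeping nonzero elements supported in any given
  infinite set of paths. The hypothesis ranges over all infinite sets so that it applies to both
  halves of a split. Once no generator is left, the class is zero.\<close>

lemma finite_codim_infinite_path_span:
  assumes "finite T" "T \<subseteq> carrier L"
    and "\<And>X. infinite X \<Longrightarrow> X \<subseteq> qpaths Q \<Longrightarrow> \<exists>f\<in>path_span X. f \<noteq> \<zero>\<^bsub>PA\<^esub> \<and> cls f \<in> M.lin_combs T"
    and "infinite X" "X \<subseteq> qpaths Q"
  shows "\<exists>f\<in>path_span X. f \<noteq> \<zero>\<^bsub>PA\<^esub> \<and> f \<in> I"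
  using assms
proof (induction T arbitrary: X rule: finite_induct)
  case empty
  obtain f where f: "f \<in> path_span X" "f \<noteq> \<zero>\<^bsub>PA\<^esub>" "cls f = \<zero>\<^bsub>L\<^esub>"
    using empty.prems(2)[OF empty.prems(3,4)] unfolding M.lin_combs_empty singleton_iff by blast
  moreover have "f \<in> I" using f(3) cls_eq_zero_iff[OF path_spanD(1)[OF f(1)]] by blast
  ultimately show ?case by blast
next
  case (insert t T)
  note W = M.lin_combs_closed[of T]
  have T: "finite T" "T \<subseteq> carrier L" "t \<in> carrier L" using insert by auto
  have eq: "M.lin_combs (insert t T) =
      {c \<odot>\<^bsub>L\<^esub> t \<oplus>\<^bsub>L\<^esub> w | c w. c \<in> carrier R \<and> w \<in> M.lin_combs T}"
    using insert by (intro M.lin_combs_insert) auto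
  txt \<open>Two combinations with disjoint supports can be combined so that the generator \<open>t\<close> cancels.\<close>
  have step: "\<exists>f\<in>path_span X. f \<noteq> \<zero>\<^bsub>PA\<^esub> \<and> cls f \<in> M.lin_combs T"
    if X: "infinite X" "X \<subseteq> qpaths Q" for X
  proof -
    obtain Y Z where YZ: "Y \<subseteq> X" "Z \<subseteq> X" "infinite Y" "infinite Z" "Y \<inter> Z = {}"
      using infinite_split[OF X(1)] .
    obtain f where f: "f \<in> path_span Y" "f \<noteq> \<zero>\<^bsub>PA\<^esub>" "cls f \<in> M.lin_combs (insert t T)"
      using insert.prems(2)[of Y] YZ X by blast
    obtain g where g: "g \<in> path_span Z" "g \<noteq> \<zero>\<^bsub>PA\<^esub>" "cls g \<in> M.lin_combs (insert t T)"
      using insert.prems(2)[of Z] YZ X by blast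
    obtain c w where cw: "c \<in> carrier R" "w \<in> M.lin_combs T" "cls f = c \<odot>\<^bsub>L\<^esub> t \<oplus>\<^bsub>L\<^esub> w"
      using f(3) eq by blast
    obtain d u where du: "d \<in> carrier R" "u \<in> M.lin_combs T" "cls g = d \<odot>\<^bsub>L\<^esub> t \<oplus>\<^bsub>L\<^esub> u"
      using g(3) eq by blast
    have wu: "w \<in> carrier L" "u \<in> carrier L" using W(1) T cw du by auto
    have fX: "f \<in> path_span X" and gX: "g \<in> path_span X"
      using f g YZ by (auto intro: path_span_mono)
    show ?thesis
    proof (cases "c = \<zero>")
      case True
      hence "cls f = w" using cw wu T by simp
      thus ?thesis using f(2) fX cw(2) by blast
    next
      case False
      \<comment> \<open>\<open>c\<close> and \<open>d\<close> are the coefficients of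
        \<open>t\<close> in the classes of \<open>f\<close> and \<open>g\<close>, so
        \<open>t\<close> drops out of \<open>c g - d f\<close>. This difference is nonzero because
        \<open>f\<close> vanishes on the support of \<open>g\<close> and \<open>c\<close> is
        nonzero.\<close>
      define h where "h = c \<odot>\<^bsub>PA\<^esub> g \<oplus>\<^bsub>PA\<^esub> (\<ominus> d) \<odot>\<^bsub>PA\<^esub> f"
      have h: "h \<in> path_span X"
        unfolding h_def using cw du fX gX by (intro path_span_add path_span_smult) auto
      have "h \<noteq> \<zero>\<^bsub>PA\<^esub>"
      proof
        assume h0: "h = \<zero>\<^bsub>PA\<^esub>"
        obtain p where p: "g p \<noteq> \<zero>" using g(2) by (auto simp: fun_eq_iff zero_eq)
        hence "f p = \<zero>" using path_spanD(2)[OF g(1)] path_spanD(3)[OF f(1)] YZ(5) by blast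
        hence "c \<otimes> g p = \<zero>" using fun_cong[OF h0, of p] cw du carrierD(1)[OF path_spanD(1)[OF g(1)]]
          by (simp add: h_def add_eq smult_eq zero_eq)
        thus False using False p cw(1) carrierD(1)[OF path_spanD(1)[OF g(1)], of p] K.integral by blast
      qed
      moreover have "cls h \<in> M.lin_combs T"
      proof -
        have "cls h = c \<odot>\<^bsub>L\<^esub> cls g \<oplus>\<^bsub>L\<^esub> (\<ominus> d) \<odot>\<^bsub>L\<^esub> cls f"
          using path_spanD(1)[OF fX] path_spanD(1)[OF gX] cw(1) du(1)
          by (simp add: h_def cls_hom smult_cls smult_closed)
        also have "\<dots> = ((c \<otimes> d) \<odot>\<^bsub>L\<^esub> t \<oplus>\<^bsub>L\<^esub> c \<odot>\<^bsub>L\<^esub> u) \<oplus>\<^bsub>L\<^esub>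
            ((\<ominus> d \<otimes> c) \<odot>\<^bsub>L\<^esub> t \<oplus>\<^bsub>L\<^esub> (\<ominus> d) \<odot>\<^bsub>L\<^esub> w)"
          unfolding cw(3) du(3) using cw(1) du(1) wu T by (simp add: M.smult_r_distr M.smult_assoc1)
        also have "\<dots> = (c \<otimes> d \<oplus> \<ominus> d \<otimes> c) \<odot>\<^bsub>L\<^esub> t \<oplus>\<^bsub>L\<^esub> (c \<odot>\<^bsub>L\<^esub> u \<oplus>\<^bsub>L\<^esub> (\<ominus> d) \<odot>\<^bsub>L\<^esub> w)"
          using cw(1) du(1) wu T by (simp add: M.smult_l_distr L.a_ac)
        also have "c \<otimes> d \<oplus> \<ominus> d \<otimes> c = \<zero>"
          using cw(1) du(1) by (simp add: R.l_minus R.m_comm[of d c] R.r_neg)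
        finally have "cls h = c \<odot>\<^bsub>L\<^esub> u \<oplus>\<^bsub>L\<^esub> (\<ominus> d) \<odot>\<^bsub>L\<^esub> w"
          using cw(1) du(1) wu T by simp
        thus ?thesis using W(4,5) T cw du by simp
      qed
      ultimately show ?thesis using h by blast
    qed
  qed
  show ?case using insert.IH[OF T(2) step insert.prems(3,4)] .
qed

text \<open>The elimination can start from generators of the whole quotient, since then any single
  path of the infinite set has its class among their combinations.\<close>

lemma finitely_generated_infinite_path_span:
  assumes "finitely_generated_module R L" "infinite X" "X \<subseteq> qpaths Q"
  obtains f where "f \<in> path_span X" "f \<noteq> \<zero>\<^bsub>PA\<^esub>" "f \<in> I"
proof -
  obtain S where S: "finite S" "S \<subseteq> carrier L" "carrier L = M.lin_combs S"
    using assms(1) M.finitely_generated_module_iff by blast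
  have "\<exists>f\<in>path_span X. f \<noteq> \<zero>\<^bsub>PA\<^esub> \<and> cls f \<in> M.lin_combs S"
    if X: "infinite X" "X \<subseteq> qpaths Q" for X
  proof -
    obtain p where p: "p \<in> X" using infinite_imp_nonempty[OF X(1)] by blast
    hence pQ: "p \<in> qpaths Q" using X(2) by blast
    have "path_elem R p p \<noteq> \<zero>\<^bsub>PA\<^esub> p" by (simp add: path_elem_def zero_eq)
    hence "path_elem R p \<noteq> \<zero>\<^bsub>PA\<^esub>" by metis
    moreover have "cls (path_elem R p) \<in> M.lin_combs S"
      using S(3) cls_closed[OF path_elem_closed[OF pQ]] by simp
    ultimately show ?thesis using path_span_elem[OF pQ p] by blast
  qed
  from finite_codim_infinite_path_span[OF S(1,2) this assms(2,3)] show thesis using that by blast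
qed

section \<open>Paths outside the ideal with a common first arrow\<close>

lemma path_elem_append_in_ideal:
  assumes "(u, as @ bs) \<in> qpaths Q"
    and "path_elem R (u, as) \<in> I \<or> path_elem R (path_target Q (u, as), bs) \<in> I"
  shows "path_elem R (u, as @ bs) \<in> I"
  using path_elem_ideal_mult[of "(path_target Q (u, as), bs)" "(u, as)"] assms
  by (auto simp: path_append_iff path_source_def path_comp_def)

text \<open>Every subpath of a path outside \<open>I\<close> is outside \<open>I\<close>, in
  particular each pair of consecutive arrows. Since \<open>special\<close> leaves at most one
  continuation of each arrow, two such paths with the same first arrow run together until the
  shorter one ends.\<close>

lemma special_prefix:
  assumes "special R Q I"
    and "(u, a # as) \<in> qpaths Q" "path_elem R (u, a # as) \<notin> I"
    and "(u, a # bs) \<in> qpaths Q" "path_elem R (u, a # bs) \<notin> I"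
    and "length as \<le> length bs"
  shows "\<exists>cs. bs = as @ cs"
  using assms(2-)
proof (induction as arbitrary: u a bs)
  case Nil
  show ?case by simp
next
  case (Cons b as)
  then obtain c cs where bs: "bs = c # cs" by (cases bs) auto
  have a: "a \<in> arcs Q" "b \<in> arcs Q" "c \<in> arcs Q" "tail Q b = head Q a" "tail Q c = head Q a"
    "u = tail Q a"
    using Cons.prems bs by (auto simp: path_Cons_iff)
  have mult: "arrow_elem R Q x \<otimes>\<^bsub>PA\<^esub> arrow_elem R Q a = path_elem R (u, [a, x])"
    if "x \<in> arcs Q" "tail Q x = head Q a" for x
    using that a by (simp add: path_elem_mult arrow_path_in) (simp add: arrow_path_def path_source_def path_comp_def)
  have "path_elem R (u, [a, b]) \<notin> I"
    using path_elem_append_in_ideal[of u "[a, b]" as] Cons.prems by auto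
  moreover have "path_elem R (u, [a, c]) \<notin> I"
    using path_elem_append_in_ideal[of u "[a, c]" cs] Cons.prems bs by auto
  moreover have "\<exists>\<^sub>\<le>\<^sub>1 x. x \<in> arcs Q \<and> tail Q x = head Q a \<and>
        arrow_elem R Q x \<otimes>\<^bsub>PA\<^esub> arrow_elem R Q a \<notin> I"
    using assms(1) a(1) unfolding special_def by blast
  ultimately have "b = c"
    using a mult unfolding Uniq_def by simp
  have "\<exists>ds. cs = as @ ds"
  proof (rule Cons.IH)
    show "(head Q a, b # as) \<in> qpaths Q" "(head Q a, b # cs) \<in> qpaths Q"
      using Cons.prems \<open>b = c\<close> bs by (auto simp: path_Cons_iff)
    show "path_elem R (head Q a, b # as) \<notin> I"
      using path_elem_append_in_ideal[of u "[a]" "b # as"] Cons.prems by auto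
    show "path_elem R (head Q a, b # cs) \<notin> I"
      using path_elem_append_in_ideal[of u "[a]" "b # cs"] Cons.prems bs \<open>b = c\<close> by auto
    show "length as \<le> length cs" using Cons.prems bs by simp
  qed
  thus ?case using bs \<open>b = c\<close> by auto
qed

section \<open>Monomiality from arrow-radicality\<close>

context
  assumes radical: "arrow_radical R Q I"
begin

lemma vertex_local:
  assumes v: "v \<in> verts Q"
  defines "e \<equiv> cls (path_elem R (trivial_path v))"
  shows "local_module (left_ideal L) (carrier L #>\<^bsub>L\<^esub> e)"
    and "module_rad (left_ideal L) (carrier L #>\<^bsub>L\<^esub> e) =
      cls ` path_span (first_arrow_in (out_arcs Q v))"
proof -
  have "out_arcs Q v \<subseteq> arcs Q" by auto
  thus "local_module (left_ideal L) (carrier L #>\<^bsub>L\<^esub> e)"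
    "module_rad (left_ideal L) (carrier L #>\<^bsub>L\<^esub> e) =
      cls ` path_span (first_arrow_in (out_arcs Q v))"
    using radical v unfolding arrow_radical_def Let_def e_def vertex_coset_def[symmetric]
    by (simp_all add: arrows_left_sum)
qed

lemma first_arrow_left_ideal: "left_ideal L (cls ` path_span (first_arrow_in S))"
proof (rule cls_path_span_left_ideal)
  fix f g assume f: "f \<in> carrier PA" and g: "g \<in> path_span (first_arrow_in S)"
  have "f \<in> path_span UNIV" using f by (intro path_spanI) auto
  thus "f \<otimes>\<^bsub>PA\<^esub> g \<in> path_span (first_arrow_in S)"
    using g by (rule path_span_mult) (auto simp: path_comp_def)
qed

text \<open>By arrow-radicality the set on the right is the radical of the local module at
  \<open>v\<close>, and a generator of a local module lies outside its radical.\<close>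

lemma vertex_notin_arrows:
  assumes v: "v \<in> verts Q"
  shows "cls (path_elem R (trivial_path v)) \<notin> cls ` path_span (first_arrow_in (out_arcs Q v))"
  using L.generator_notin_local_rad[OF cls_closed[OF path_elem_closed[OF triv_path[OF v]]] vertex_local(1)[OF v]]
  unfolding vertex_local(2)[OF v] .

lemma vertex_notin_ideal:
  assumes v: "v \<in> verts Q"
  shows "path_elem R (trivial_path v) \<notin> I"
proof
  assume "path_elem R (trivial_path v) \<in> I"
  hence "cls (path_elem R (trivial_path v)) = \<zero>\<^bsub>L\<^esub>"
    using path_elem_closed[OF triv_path[OF v]] by (simp only: cls_eq_zero_iff)
  moreover have "\<zero>\<^bsub>L\<^esub> \<in> cls ` path_span (first_arrow_in (out_arcs Q v))"
    by (rule L.left_idealD(2)[OF first_arrow_left_ideal])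
  ultimately have "cls (path_elem R (trivial_path v)) \<in> cls ` path_span (first_arrow_in (out_arcs Q v))"
    by (simp only:)
  with vertex_notin_arrows[OF v] show False by contradiction
qed

text \<open>\<open>c e\<^sub>v + j\<close> generates the local module \<open>\<Lambda>e\<^sub>v\<close>, so it can be cancelled on the left of a path.\<close>
lemma path_in_ideal_if_unit_multiple:
  assumes p: "p \<in> qpaths Q" "path_target Q p = v" and c: "c \<in> carrier R" "c \<noteq> \<zero>"
    and j: "j \<in> path_span (first_arrow_in (out_arcs Q v))"
    and I: "(c \<odot>\<^bsub>PA\<^esub> path_elem R (trivial_path v) \<oplus>\<^bsub>PA\<^esub> j) \<otimes>\<^bsub>PA\<^esub> path_elem R p \<in> I"
  shows "path_elem R p \<in> I"
proof -
  let ?e = "path_elem R (trivial_path v)" and ?J = "cls ` path_span (first_arrow_in (out_arcs Q v))"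
  have v: "v \<in> verts Q" using p target_in_verts by blast
  note e = path_elem_closed[OF triv_path[OF v]] and jc = path_spanD(1)[OF j]
    and pc = path_elem_closed[OF p(1)] and J = first_arrow_left_ideal[of "out_arcs Q v"]
  define f where "f = c \<odot>\<^bsub>PA\<^esub> ?e \<oplus>\<^bsub>PA\<^esub> j"
  have fc: "f \<in> carrier PA" unfolding f_def using c e jc by (simp add: add_closed smult_closed)
  \<comment> \<open>Otherwise subtracting \<open>j\<close> and dividing by \<open>c\<close> would
    put the class of the trivial path into the radical.\<close>
  have "cls f \<notin> ?J"
  proof
    assume fJ: "cls f \<in> ?J"
    have "(\<ominus> \<one>) \<odot>\<^bsub>L\<^esub> cls j \<in> ?J" using j by (intro left_ideal_smult[OF J]) auto
    with fJ have "cls f \<oplus>\<^bsub>L\<^esub> (\<ominus> \<one>) \<odot>\<^bsub>L\<^esub> cls j \<in> ?J" by (rule L.left_idealD(3)[OF J])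
    also have "cls f \<oplus>\<^bsub>L\<^esub> (\<ominus> \<one>) \<odot>\<^bsub>L\<^esub> cls j = c \<odot>\<^bsub>L\<^esub> cls ?e"
      using cls_add_cancel[OF smult_closed[OF c(1) e] jc] smult_cls[OF c(1) e] by (simp only: f_def)
    finally have "inv c \<odot>\<^bsub>L\<^esub> (c \<odot>\<^bsub>L\<^esub> cls ?e) \<in> ?J"
      using field_inv_closed[OF c] by (rule left_ideal_smult[OF J])
    thus False using vertex_notin_arrows[OF v] smult_cancel[OF c cls_closed[OF e]] by simp
  qed
  moreover have "cls f \<in> carrier L #>\<^bsub>L\<^esub> cls ?e"
  proof -
    have "j \<in> path_span (starting_at v)"
      using j unfolding out_arcs_span by (rule path_span_mono) auto
    hence "f \<in> path_span (starting_at v)"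
      unfolding f_def using c v
      by (intro path_span_add path_span_smult path_span_elem triv_path) (auto simp: trivial_path_def)
    thus ?thesis using vertex_left_module[OF v] by (simp add: vertex_coset_def)
  qed
  ultimately have "cls ?e \<in> carrier L #>\<^bsub>L\<^esub> cls f"
    using L.local_left_module_generator[OF cls_closed[OF e] vertex_local(1)[OF v]]
    unfolding vertex_local(2)[OF v] by blast
  then obtain y where y: "y \<in> carrier L" "cls ?e = y \<otimes>\<^bsub>L\<^esub> cls f" by (auto simp: r_coset_def)
  \<comment> \<open>In the quotient \<open>p = e\<^sub>v p = y f p\<close>, and \<open>f p\<close>
    vanishes by assumption.\<close>
  have "cls (path_elem R p) = cls ?e \<otimes>\<^bsub>L\<^esub> cls (path_elem R p)"
    using e pc path_elem_vertex_left[OF p] by (simp add: cls_hom)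
  also have "\<dots> = y \<otimes>\<^bsub>L\<^esub> (cls f \<otimes>\<^bsub>L\<^esub> cls (path_elem R p))"
    unfolding y(2) using y(1) cls_closed[OF fc] cls_closed[OF pc] by (rule L.m_assoc)
  also have "cls f \<otimes>\<^bsub>L\<^esub> cls (path_elem R p) = \<zero>\<^bsub>L\<^esub>"
    unfolding cls_hom(1)[OF fc pc] cls_eq_zero_iff[OF mult_closed[OF fc pc]] unfolding f_def by (rule I)
  finally have "cls (path_elem R p) = \<zero>\<^bsub>L\<^esub>" using y(1) by simp
  thus ?thesis using pc by (simp only: cls_eq_zero_iff)
qed

text \<open>Terms of \<open>f\<close> already in \<open>I\<close> are stripped off; the rest
  \<open>h\<close> still lies in \<open>I\<close>. A shortest path \<open>q\<close> of
  \<open>h\<close> is an initial piece of all its paths, so \<open>h\<close> has the form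
  \<open>(c e\<^sub>v + j) q\<close> with \<open>c\<close> nonzero, and cancellation puts
  \<open>q\<close> into \<open>I\<close>, although the paths of \<open>h\<close> were chosen outside
  \<open>I\<close>.\<close>

lemma first_arrow_monomial:
  assumes special: "special R Q I" and a: "a \<in> arcs Q"
    and f: "f \<in> I" "f \<in> path_span (first_arrow_in {a})" "f p \<noteq> \<zero>"
  shows "path_elem R p \<in> I"
proof (rule ccontr)
  assume pI: "path_elem R p \<notin> I"
  let ?X = "{p. path_elem R p \<in> I}"
  have "f \<in> path_span (?X \<union> first_arrow_in {a})" using f(2) by (rule path_span_mono) auto
  then obtain g h where gh: "g \<in> path_span ?X" "h \<in> path_span (first_arrow_in {a} - ?X)"
    "f = g \<oplus>\<^bsub>PA\<^esub> h" "\<And>p. p \<notin> ?X \<Longrightarrow> h p = f p"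
    by (rule path_span_restrict) blast
  have hc: "h \<in> carrier PA" and gc: "g \<in> carrier PA" using gh path_spanD(1) by auto
  have "g \<in> I" using path_spanD(2)[OF gh(1)] by (intro in_idealI[OF gc]) auto
  hence "f \<oplus>\<^bsub>PA\<^esub> (\<ominus> \<one>) \<odot>\<^bsub>PA\<^esub> g \<in> I" 
    by (intro additive_subgroup.a_closed[OF A.is_additive_subgroup f(1)] smult_in_ideal) auto
  also have "f \<oplus>\<^bsub>PA\<^esub> (\<ominus> \<one>) \<odot>\<^bsub>PA\<^esub> g = h"
    unfolding gh(3) A.a_comm[OF gc hc] using carrierD(1)[OF gc] carrierD(1)[OF hc]
    by (auto simp: fun_eq_iff add_eq smult_eq R.l_minus R.a_assoc R.r_neg)
  finally have hI: "h \<in> I" .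
  have "h p \<noteq> \<zero>" using gh(4) pI f(3) by simp
  then obtain q where q: "h q \<noteq> \<zero>" "\<And>r. h r \<noteq> \<zero> \<Longrightarrow> path_length q \<le> path_length r"
    using ex_has_least_nat[of "\<lambda>q. h q \<noteq> \<zero>" p path_length] by blast
  have supp: "r \<in> qpaths Q" "snd r \<noteq> []" "hd (snd r) = a" "path_elem R r \<notin> I" if "h r \<noteq> \<zero>" for r
    using path_spanD(2)[OF gh(2) that] carrierD(2)[OF hc, of r] that by blast+
  note qs = supp[OF q(1)]
  have qc: "path_elem R q \<in> carrier PA" using qs by (simp add: path_elem_closed)
  define v where "v = path_target Q q"
  let ?Y = "first_arrow_in (out_arcs Q v)"
  have v: "v \<in> verts Q" unfolding v_def using qs by (intro target_in_verts)
  have "h(q := \<zero>) \<in> path_span {path_comp s q | s. s \<in> ?Y \<and> s \<in> qpaths Q \<and> path_source s = path_target Q q}"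
  proof (rule path_spanI)
    show "h(q := \<zero>) \<in> carrier PA" using path_span_upd[OF gh(2)] by (rule path_spanD(1))
    fix r assume "(h(q := \<zero>)) r \<noteq> \<zero>"
    hence r: "r \<noteq> q" "h r \<noteq> \<zero>" by (auto split: if_splits)
    note rs = supp[OF r(2)]
    obtain u as bs where ub: "q = (u, a # as)" "r = (u, a # bs)"
    proof -
      have "fst q = fst r" using path_hd(2)[OF qs(1,2)] path_hd(2)[OF rs(1,2)] qs rs by simp
      thus thesis using that[of "fst q" "tl (snd q)" "tl (snd r)"] qs rs
        by (metis list.collapse prod.collapse)
    qed
    have "length as \<le> length bs" using q(2)[OF r(2)] ub by (simp add: path_length_def)
    then obtain cs where cs: "bs = as @ cs"
      using special_prefix[OF special, of u a as bs] qs(1,4) rs(1,4) unfolding ub by blast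
    \<comment> \<open>The extension of \<open>q\<close> to \<open>r\<close> has to be nontrivial for
      the cofactor \<open>j\<close> to lie in the span of the nontrivial paths; this is where
      \<open>r \<noteq> q\<close> enters.\<close>
    have cne: "cs \<noteq> []" using r(1) ub cs by auto
    have "(u, (a # as) @ cs) \<in> qpaths Q" using rs(1) ub cs by simp
    hence sQ: "(v, cs) \<in> qpaths Q" unfolding path_append_iff v_def ub(1) by blast
    have "(v, cs) \<in> ?Y" using path_hd[OF sQ] cne by simp
    moreover have "r = path_comp (v, cs) q" using ub cs by (simp add: path_comp_def)
    ultimately show "r \<in> {path_comp s q | s. s \<in> ?Y \<and> s \<in> qpaths Q \<and> path_source s = path_target Q q}"
      using sQ v_def by (auto simp: path_source_def intro!: exI[of _ v] exI[of _ cs])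
  qed
  from path_span_comp_right[OF this qs(1)]
  obtain j where j: "j \<in> path_span ?Y" "h(q := \<zero>) = j \<otimes>\<^bsub>PA\<^esub> path_elem R q" by blast
  let ?e = "path_elem R (trivial_path v)"
  have hq: "h q \<in> carrier R" by (rule carrierD(1)[OF hc])
  note e = path_elem_closed[OF triv_path[OF v]]
  have "(h q \<odot>\<^bsub>PA\<^esub> ?e \<oplus>\<^bsub>PA\<^esub> j) \<otimes>\<^bsub>PA\<^esub> path_elem R q =
      h q \<odot>\<^bsub>PA\<^esub> path_elem R q \<oplus>\<^bsub>PA\<^esub> j \<otimes>\<^bsub>PA\<^esub> path_elem R q"
    using hq e qc path_spanD(1)[OF j(1)] path_elem_vertex_left[OF qs(1) v_def[symmetric]]
    by (simp add: A.l_distr smult_closed smult_mult)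
  also have "\<dots> = h" unfolding j(2)[symmetric] by (rule path_split[OF hc qs(1), symmetric])
  finally have "(h q \<odot>\<^bsub>PA\<^esub> ?e \<oplus>\<^bsub>PA\<^esub> j) \<otimes>\<^bsub>PA\<^esub> path_elem R q \<in> I" using hI by simp
  from path_in_ideal_if_unit_multiple[OF qs(1) v_def[symmetric] hq q(1) j(1) this] qs(4)
  show False by contradiction
qed

text \<open>The support is cut down until \<open>first_arrow_monomial\<close> applies:
  multiplication by \<open>e\<^sub>v\<close> selects the source of \<open>p\<close>, the coefficient
  at \<open>e\<^sub>v\<close> turns out to vanish, and arrow-directness isolates the first arrow of
  \<open>p\<close>.\<close>

lemma string_monomial:
  assumes special: "special R Q I" and direct: "arrow_direct R Q I" and f: "f \<in> I" "f p \<noteq> \<zero>"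
  shows "path_elem R p \<in> I"
proof -
  have fc: "f \<in> carrier PA" using f(1) by (rule A.Icarr)
  have pQ: "p \<in> qpaths Q" using carrierD(2)[OF fc] f(2) by blast
  define v where "v = fst p"
  have v: "v \<in> verts Q" unfolding v_def using pQ by (rule source_in_verts)
  let ?e = "path_elem R (trivial_path v)"
  note e = path_elem_closed[OF triv_path[OF v]]
  \<comment> \<open>The union is all of \<open>UNIV\<close>, written in this form so that
    \<open>path_span_restrict\<close> separates the paths starting at \<open>v\<close> from the
    others.\<close>
  have "f \<in> path_span (starting_at v \<union> UNIV)" using fc by (intro path_spanI) auto
  then obtain g h where gh: "g \<in> path_span (starting_at v)" "h \<in> path_span (UNIV - starting_at v)"
    "f = g \<oplus>\<^bsub>PA\<^esub> h" "\<And>p. p \<in> starting_at v \<Longrightarrow> g p = f p"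
    by (rule path_span_restrict) blast
  have gc: "g \<in> carrier PA" using gh path_spanD(1) by auto
  have "h \<otimes>\<^bsub>PA\<^esub> ?e \<in> path_span {}"
    by (rule path_span_mult[OF gh(2) path_span_elem[OF triv_path[OF v] singletonI]])
      (auto simp: path_source_def trivial_path_def)
  hence "f \<otimes>\<^bsub>PA\<^esub> ?e = g"
    unfolding gh(3) using gc path_spanD(1)[OF gh(2)] e path_span_starting_at[OF gh(1) v]
    by (simp add: A.l_distr path_span_empty)
  hence gI: "g \<in> I" using A.I_r_closed[OF f(1) e] by simp
  have gp: "g p \<noteq> \<zero>" using gh(4) f(2) v_def by simp
  obtain j where j: "g = g (trivial_path v) \<odot>\<^bsub>PA\<^esub> ?e \<oplus>\<^bsub>PA\<^esub> j"
      "j \<in> path_span (starting_at v \<inter> {p. snd p \<noteq> []})"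
    using gh(1) v starting_at_trivial by (rule path_span_vertex_split)
  have jY: "j \<in> path_span (first_arrow_in (out_arcs Q v))" using j(2) unfolding out_arcs_span .
  \<comment> \<open>A nonzero coefficient would allow cancellation in \<open>g e\<^sub>v\<close>, an
    element of \<open>I\<close>, and thereby put \<open>e\<^sub>v\<close> itself into
    \<open>I\<close>.\<close>
  have g0: "g (trivial_path v) = \<zero>"
  proof (rule ccontr)
    assume "g (trivial_path v) \<noteq> \<zero>"
    moreover have "(g (trivial_path v) \<odot>\<^bsub>PA\<^esub> ?e \<oplus>\<^bsub>PA\<^esub> j) \<otimes>\<^bsub>PA\<^esub> ?e \<in> I"
      using A.I_r_closed[OF gI e] j(1) by simp
    ultimately have "?e \<in> I"
      using path_in_ideal_if_unit_multiple[OF triv_path[OF v] _ carrierD(1)[OF gc] _ jY]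
      by (simp add: trivial_path_def)
    thus False using vertex_notin_ideal[OF v] by contradiction
  qed
  have ne: "snd p \<noteq> []"
    using gp g0 starting_at_trivial[of p v] v_def by auto
  define a where "a = hd (snd p)"
  have a: "a \<in> arcs Q" "tail Q a = v" unfolding a_def v_def using path_hd[OF pQ ne] by auto
  have "g = j" using j(1) g0 e carrierD(1)[OF e] carrierD(1)[OF path_spanD(1)[OF j(2)]]
    by (auto simp: fun_eq_iff add_eq smult_eq)
  let ?S = "out_arcs Q v - {a}"
  have "g \<in> path_span (first_arrow_in {a} \<union> first_arrow_in ?S)"
    using jY unfolding \<open>g = j\<close> by (rule path_span_mono) auto
  then obtain k l where kl: "k \<in> path_span (first_arrow_in {a})"
    "l \<in> path_span (first_arrow_in ?S - first_arrow_in {a})"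
    "g = k \<oplus>\<^bsub>PA\<^esub> l" "\<And>p. p \<in> first_arrow_in {a} \<Longrightarrow> k p = g p"
    by (rule path_span_restrict) blast
  have kc: "k \<in> carrier PA" and lc: "l \<in> carrier PA" using kl path_spanD(1) by auto
  \<comment> \<open>With \<open>m = - l\<close>, \<open>k\<close> differs from \<open>m\<close> by
    the element \<open>g\<close> of \<open>I\<close>; their common class lies in both modules that
    \<open>arrow_direct\<close> intersects, so \<open>k\<close> is in \<open>I\<close>.\<close>
  define m where "m = (\<ominus> \<one>) \<odot>\<^bsub>PA\<^esub> l"
  have "l \<in> path_span (first_arrow_in ?S)" using kl(2) by (rule path_span_mono) auto
  hence m: "m \<in> path_span (first_arrow_in ?S)" unfolding m_def by (intro path_span_smult) auto
  have mc: "m \<in> carrier PA" using m by (rule path_spanD(1))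
  have "k = g \<oplus>\<^bsub>PA\<^esub> m"
    unfolding kl(3) m_def using carrierD(1)[OF kc] carrierD(1)[OF lc]
    by (auto simp: fun_eq_iff add_eq smult_eq R.l_minus R.a_assoc R.r_neg)
  hence "cls k = cls m" using cls_add_ideal[OF gI mc] by simp
  hence "cls k \<in> cls ` path_span (first_arrow_in {a}) \<inter> cls ` path_span (first_arrow_in ?S)"
    using kl(1) m by auto
  moreover have "cls ` path_span (first_arrow_in {a}) \<inter> cls ` path_span (first_arrow_in ?S) = {\<zero>\<^bsub>L\<^esub>}"
  proof -
    have S: "?S \<subseteq> arcs Q" by auto
    have "(carrier L #>\<^bsub>L\<^esub> arrow_coset R Q I a) \<inter>
        left_sum L (arrow_coset R Q I) (out_arcs Q (tail Q a) - {a}) = {\<zero>\<^bsub>L\<^esub>}"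
      using direct a(1) by (simp add: arrow_direct_def Let_def)
    thus ?thesis unfolding a(2) arrow_left_module[OF a(1)] arrows_left_sum[OF S] .
  qed
  ultimately have "cls k = \<zero>\<^bsub>L\<^esub>" by (simp only: singleton_iff)
  hence "k \<in> I" using kc by (simp only: cls_eq_zero_iff)
  moreover have "k p \<noteq> \<zero>" using kl(4) gp ne a_def by simp
  ultimately show ?thesis using first_arrow_monomial[OF special a(1) _ kl(1)] by blast
qed

end

text \<open>By monomiality \<open>I\<close> is generated by the set \<open>P\<close> of all paths in
  it. Length 0 is excluded in \<open>P\<close> by locality at the vertices, length 1 by
  permissibility. If infinitely many paths lay outside \<open>I\<close>, finite generation would
  give a nonzero element of \<open>I\<close> supported on them, against monomiality.\<close>

lemma string_algebra_imp_butler_ringel: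
  assumes "string_algebra R Q I"
  shows "butler_ringel_string_algebra R Q I"
proof -
  have sa: "finitely_generated_module R L" "at_most_two_heads_and_tails Q" "arrow_radical R Q I"
    "arrow_direct R Q I" "permissible R Q I" "special R Q I"
    using assms by (auto simp: string_algebra_def)
  note mono = string_monomial[OF sa(3,6,4)]
  define P where "P = {p \<in> qpaths Q. path_elem R p \<in> I}"
  have long: "2 \<le> path_length p" if "p \<in> P" for p
  proof (rule ccontr)
    assume "\<not> 2 \<le> path_length p"
    then consider "snd p = []" | a where "snd p = [a]"
      by (cases "snd p"; cases "tl (snd p)") (auto simp: path_length_def)
    thus False
    proof cases
      case 1
      hence "p = trivial_path (fst p)" by (simp add: trivial_path_def prod_eq_iff)
      thus False
        using that vertex_notin_ideal[OF sa(3), of "fst p"] source_in_verts[of p] by (simp add: P_def)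
    next
      case (2 a)
      hence "a \<in> arcs Q" "p = arrow_path Q a"
        using that path_hd[of p] by (auto simp: P_def arrow_path_def prod_eq_iff)
      thus False using sa(5) that by (auto simp: permissible_def P_def)
    qed
  qed
  have "generated_by_long_paths R Q I"
    unfolding generated_by_long_paths_def
  proof (intro exI[of _ P] conjI equalityI)
    show "P \<subseteq> {p \<in> qpaths Q. 2 \<le> path_length p}" using long by (auto simp: P_def)
    have PQ: "path_elem R ` P \<subseteq> carrier PA" by (auto simp: P_def path_elem_closed)
    show "genideal PA (path_elem R ` P) \<subseteq> I"
      using A.is_ideal by (rule A.genideal_minimal) (auto simp: P_def)
    \<comment> \<open>Viewing the generated ideal as the ideal of a second quotient makes
      \<open>J.in_idealI\<close> available, so membership is checked on the paths of the support
      only.\<close>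
    interpret J: quiver_quotient R Q "genideal PA (path_elem R ` P)"
      by (intro quiver_quotient.intro quiver_path_algebra_axioms A.genideal_ideal PQ)
    show "I \<subseteq> genideal PA (path_elem R ` P)"
    proof
      fix f assume f: "f \<in> I"
      show "f \<in> genideal PA (path_elem R ` P)"
      proof (rule J.in_idealI[OF A.Icarr[OF f]])
        fix p assume "p \<in> qpaths Q" "f p \<noteq> \<zero>"
        hence "p \<in> P" using mono[OF f] by (simp add: P_def)
        thus "path_elem R p \<in> genideal PA (path_elem R ` P)" using A.genideal_self[OF PQ] by blast
      qed
    qed
  qed
  moreover have "arrowwise_bounded R Q I"
  proof -
    have "finite (qpaths Q - P)"
    proof (rule ccontr)
      assume "infinite (qpaths Q - P)"
      then obtain f where f: "f \<in> path_span (qpaths Q - P)" "f \<noteq> \<zero>\<^bsub>PA\<^esub>" "f \<in> I"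
        using finitely_generated_infinite_path_span[OF sa(1), of "qpaths Q - P"] by blast
      obtain p where p: "f p \<noteq> \<zero>" using f(2) by (auto simp: fun_eq_iff zero_eq)
      thus False using mono[OF f(3) p] path_spanD(2)[OF f(1) p] by (auto simp: P_def)
    qed
    hence "finite (path_length ` (qpaths Q - P))" by (rule finite_imageI)
    \<comment> \<open>Only finitely many lengths occur outside \<open>I\<close>, so a single
      \<open>n\<close> above all of them serves every arrow.\<close>
    then obtain n where n: "\<forall>m\<in>path_length ` (qpaths Q - P). m < n"
      unfolding finite_nat_set_iff_bounded by blast
    have bound: "path_elem R p \<in> I" if "p \<in> qpaths Q" "n \<le> path_length p" for p
    proof (rule ccontr)
      assume "path_elem R p \<notin> I"
      hence "p \<in> qpaths Q - P" using that(1) by (simp add: P_def)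
      thus False using n that(2) by force
    qed
    show ?thesis
      unfolding arrowwise_bounded_def by (intro ballI exI[of _ n] impI) (rule bound; simp)
  qed
  ultimately show ?thesis
    unfolding butler_ringel_string_algebra_def
    using sa Q.fin_digraph_axioms A.is_ideal K.field_axioms by simp
qed

end

theorem proposition6p2:
  fixes k :: "('r, 's) ring_scheme"
    and Q :: "('v, 'e) pre_digraph"
    and I :: "(('v, 'e) qpath \<Rightarrow> 'r) set"
  assumes "field k"
    and "fin_digraph Q"
    and "ideal I (path_algebra k Q)"
  shows "string_algebra k Q I \<longleftrightarrow> butler_ringel_string_algebra k Q I"
proof -
  interpret field_quiver_quotient k Q I
    using assms unfolding field_quiver_quotient_def quiver_quotient_def quiver_path_algebra_def
    by (auto simp: field_def domain_def)
  show ?thesis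
    using string_algebra_imp_butler_ringel butler_ringel_imp_string_algebra by blast
qed

end
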